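(* Let $M$ be a monoid, let $X$ be a set, and let $R$ be a set of admissible identities over $X^*$. (1) The restriction monoid $\mathcal{FR}_R(M)$ is $F$-restriction and $\tau_{\mathcal{FR}_R(M)}=\iota_{\mathcal{FR}_R(M)}$ (where $\mathcal{FR}_R(M)/\sigma$ is identified with $M$ via $p_M$). In particular, $\mathcal{FR}_R(M)$ is proper. (2) Let $S$ be an $F$-restriction monoid such that $S/\sigma\simeq M$ (and identify $S/\sigma$ with $M$), and assume that the premorphism $\tau_S\colon M\to S$ satisfies all the identities in $R$. Then there is a morphism of restriction monoids $\eta\colon\mathcal{FR}_R(M)\to S$ such that $\eta(\lfloor m\rfloor)=\tau_S(m)$ for all $m\in M$ and $p_M=\sigma_S^\natural\eta$.
   Context: Restriction monoids. A restriction semigroup is an algebra $(S;\cdot,{}^*,{}^+)$ with $(S;\cdot)$ a semigroup satisfying $x^+x=x$, $x^+y^+=y^+x^+$, $(x^+y)^+=x^+y^+$, $xy^+=(xy)^+x$; $xx^*=x$, $x^*y^*=y^*x^*$, $(xy^* )^*=x^*y^*$, $x^*y=y(xy)^*$; $(x^+)^*=x^+$, $(x^* )^+=x^*$. A restriction monoid is a restriction semigroup with an identity element, in signature $(\cdot,{}^*,{}^+,1)$; morphisms preserve all operations. $P(S)=\{s^*:s\in S\}=\{s^+:s\in S\}$ is the semilattice of projections. Natural partial order: $s\le t$ iff $s=et$ for some $e\in P(S)$. Every monoid is a (reduced) restriction monoid with $s^*=s^+=1$. $\sigma$ is the minimum congruence on a restriction semigroup $S$ identifying all elements of $P(S)$;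 $S/\sigma$ is a monoid (a reduced restriction monoid), and $\sigma_S^\natural\colon S\to S/\sigma$ is the quotient morphism. $S$ is proper if, for all $s,t\in S$, ($s^*=t^*$ and $s\mathrel\sigma t$) implies $s=t$, and ($s^+=t^+$ and $s\mathrel\sigma t$) implies $s=t$. $S$ is $F$-restriction if every $\sigma$-class has a maximum element with respect to $\le$ (then $S$ is necessarily a monoid). For $F$-restriction $S$, $\tau_S\colon S/\sigma\to S$ sends $t\in S/\sigma$ to the maximum element of the $\sigma$-class $t$; it is a premorphism. A premorphism from a monoid $M$ to a restriction monoid $T$ is a map $\varphi$ with $\varphi(1)=1$ and $\varphi(m)\varphi(n)\le\varphi(mn)$ for all $m,n$. Identities. $X^*$ is the free monoid on a set $X$ (empty word $\lambda$), and $FR(X^* )$ is the free restriction monoid on the set $X^*$ (its product is written $\cdot$, its identity is $1\neq\lambda$; the generator $uv$ is different from the product $u\cdot v$). For a map $f\colon X\to M$ into a monoid, with monoid-morphism extension $\widehat f\colon X^*\to M$, and a map $\gamma\colon M\to S$ into a restriction monoid, the value $[p]_{\gamma,f}\in S$ of $p\in FR(X^* )$ is the image of $p$ under the morphism $FR(X^* )\to S$ sending each generator $u\in X^*$ to $\gamma(\widehat f(u))$. An identity over $X^*$ is an equality $p=q$ with $p,q\in FR(X^* )$; $\gamma$ satisfies it if $[p]_{\gamma,f}=[q]_{\gamma,f}$ for all $f\colon X\to M$. An identity is admissible if every monoid morphism from a monoid to a restriction monoid satisfies it. $\mathcal{FR}_R(M)$ is the restriction monoid generated by the set $\{\lfloor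 m\rfloor:m\in M\}$ subject to the relations $\lfloor 1\rfloor=1$, $\lfloor m\rfloor\lfloor n\rfloor=\lfloor mn\rfloor(\lfloor m\rfloor\lfloor n\rfloor)^*$ ($m,n\in M$), and $[p]_{\iota,f}=[q]_{\iota,f}$ for all $p=q$ in $R$ and all $f\colon X\to M$, where $\iota(m)=\lfloor m\rfloor$. Denote by $\iota_{\mathcal{FR}_R(M)}\colon M\to\mathcal{FR}_R(M)$ the map $m\mapsto\lfloor m\rfloor$, and by $p_M\colon\mathcal{FR}_R(M)\to M$ the morphism of restriction monoids ($M$ regarded as reduced) determined by $p_M(\lfloor m\rfloor)=m$. The kernel of $p_M$ is $\sigma$, so $p_M$ induces an isomorphism $\mathcal{FR}_R(M)/\sigma\simeq M$, used to identify the two. *)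

theory Defs
  imports "HOL-Algebra.Group"
begin

section \<open>Restriction semigroups and monoids\<close>

record 'a rmonoid = "'a monoid" +
  rstar :: "'a \<Rightarrow> 'a"
  rplus :: "'a \<Rightarrow> 'a"

text \<open>The field \<open>one\<close> of the record is irrelevant for restriction semigroups.\<close>

locale restriction_semigroup =
  fixes S :: "('a, 'e) rmonoid_scheme" (structure)
  assumes mult_closed: "\<lbrakk>x \<in> carrier S; y \<in> carrier S\<rbrakk> \<Longrightarrow> x \<otimes> y \<in> carrier S"
    and mult_assoc: "\<lbrakk>x \<in> carrier S; y \<in> carrier S; z \<in> carrier S\<rbrakk>
          \<Longrightarrow> (x \<otimes> y) \<otimes> z = x \<otimes> (y \<otimes> z)"
    and rplus_closed: "x \<in> carrier S \<Longrightarrow> rplus S x \<in> carrier S"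
    and rstar_closed: "x \<in> carrier S \<Longrightarrow> rstar S x \<in> carrier S"
    and rplus_left: "x \<in> carrier S \<Longrightarrow> rplus S x \<otimes> x = x"
    and rplus_comm: "\<lbrakk>x \<in> carrier S; y \<in> carrier S\<rbrakk>
          \<Longrightarrow> rplus S x \<otimes> rplus S y = rplus S y \<otimes> rplus S x"
    and rplus_mult: "\<lbrakk>x \<in> carrier S; y \<in> carrier S\<rbrakk>
          \<Longrightarrow> rplus S (rplus S x \<otimes> y) = rplus S x \<otimes> rplus S y"
    and rplus_ample: "\<lbrakk>x \<in> carrier S; y \<in> carrier S\<rbrakk>
          \<Longrightarrow> x \<otimes> rplus S y = rplus S (x \<otimes> y) \<otimes> x"
    and rstar_right: "x \<in> carrier S \<Longrightarrow> x \<otimes> rstar S x = x"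
    and rstar_comm: "\<lbrakk>x \<in> carrier S; y \<in> carrier S\<rbrakk>
          \<Longrightarrow> rstar S x \<otimes> rstar S y = rstar S y \<otimes> rstar S x"
    and rstar_mult: "\<lbrakk>x \<in> carrier S; y \<in> carrier S\<rbrakk>
          \<Longrightarrow> rstar S (x \<otimes> rstar S y) = rstar S x \<otimes> rstar S y"
    and rstar_ample: "\<lbrakk>x \<in> carrier S; y \<in> carrier S\<rbrakk>
          \<Longrightarrow> rstar S x \<otimes> y = y \<otimes> rstar S (x \<otimes> y)"
    and rstar_rplus: "x \<in> carrier S \<Longrightarrow> rstar S (rplus S x) = rplus S x"
    and rplus_rstar: "x \<in> carrier S \<Longrightarrow> rplus S (rstar S x) = rstar S x"

locale restriction_monoid = restriction_semigroup S + monoid S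
  for S :: "('a, 'e) rmonoid_scheme" (structure)

definition mon_hom :: "('a, 'c) monoid_scheme \<Rightarrow> ('b, 'd) monoid_scheme \<Rightarrow> ('a \<Rightarrow> 'b) set" where
  "mon_hom M N = {h \<in> hom M N. h \<one>\<^bsub>M\<^esub> = \<one>\<^bsub>N\<^esub>}"

definition rm_hom :: "('a, 'c) rmonoid_scheme \<Rightarrow> ('b, 'd) rmonoid_scheme \<Rightarrow> ('a \<Rightarrow> 'b) set" where
  "rm_hom S T = {h \<in> mon_hom S T. \<forall>x\<in>carrier S.
     h (rstar S x) = rstar T (h x) \<and> h (rplus S x) = rplus T (h x)}"

definition reduced :: "('a, 'e) monoid_scheme \<Rightarrow> 'a rmonoid" where
  "reduced M = \<lparr>carrier = carrier M, mult = mult M, one = one M,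
     rstar = (\<lambda>_. \<one>\<^bsub>M\<^esub>), rplus = (\<lambda>_. \<one>\<^bsub>M\<^esub>)\<rparr>"

definition projections :: "('a, 'e) rmonoid_scheme \<Rightarrow> 'a set" where
  "projections S = rstar S ` carrier S"

definition natural_le :: "('a, 'e) rmonoid_scheme \<Rightarrow> 'a \<Rightarrow> 'a \<Rightarrow> bool" where
  "natural_le S s t \<longleftrightarrow> (\<exists>e\<in>projections S. s = e \<otimes>\<^bsub>S\<^esub> t)"

section \<open>Congruences and quotients\<close>

definition congruence :: "('a, 'e) rmonoid_scheme \<Rightarrow> 'a rel \<Rightarrow> bool" where
  "congruence S r \<longleftrightarrow> equiv (carrier S) r
     \<and> (\<forall>(a, b)\<in>r. \<forall>(c, d)\<in>r. (a \<otimes>\<^bsub>S\<^esub> c, b \<otimes>\<^bsub>S\<^esub> d) \<in> r)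
     \<and> (\<forall>(a, b)\<in>r. (rstar S a, rstar S b) \<in> r \<and> (rplus S a, rplus S b) \<in> r)"

definition cong_gen :: "('a, 'e) rmonoid_scheme \<Rightarrow> 'a rel \<Rightarrow> 'a rel" where
  "cong_gen S E = \<Inter>{r. congruence S r \<and> E \<subseteq> r}"

definition quot :: "('a, 'e) rmonoid_scheme \<Rightarrow> 'a rel \<Rightarrow> 'a set rmonoid" where
  "quot S r = \<lparr>carrier = carrier S // r,
     mult = (\<lambda>A B. \<Union>a\<in>A. \<Union>b\<in>B. r `` {a \<otimes>\<^bsub>S\<^esub> b}),
     one = r `` {\<one>\<^bsub>S\<^esub>},
     rstar = (\<lambda>A. \<Union>a\<in>A. r `` {rstar S a}),
     rplus = (\<lambda>A. \<Union>a\<in>A. r `` {rplus S a})\<rparr>"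

definition sigma :: "('a, 'e) rmonoid_scheme \<Rightarrow> 'a rel" where
  "sigma S = cong_gen S (projections S \<times> projections S)"

definition sigma_nat :: "('a, 'e) rmonoid_scheme \<Rightarrow> 'a \<Rightarrow> 'a set" where
  "sigma_nat S s = sigma S `` {s}"

definition proper :: "('a, 'e) rmonoid_scheme \<Rightarrow> bool" where
  "proper S \<longleftrightarrow> restriction_semigroup S \<and> (\<forall>s\<in>carrier S. \<forall>t\<in>carrier S.
     (rstar S s = rstar S t \<and> (s, t) \<in> sigma S \<longrightarrow> s = t) \<and>
     (rplus S s = rplus S t \<and> (s, t) \<in> sigma S \<longrightarrow> s = t))"

definition is_max :: "('a, 'e) rmonoid_scheme \<Rightarrow> 'a set \<Rightarrow> 'a \<Rightarrow> bool" where
  "is_max S C m \<longleftrightarrow> m \<in> C \<and> (\<forall>s\<in>C. natural_le S s m)"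

definition F_restriction :: "('a, 'e) rmonoid_scheme \<Rightarrow> bool" where
  "F_restriction S \<longleftrightarrow>
     restriction_semigroup S \<and> (\<forall>C\<in>carrier S // sigma S. \<exists>m. is_max S C m)"

definition tau :: "('a, 'e) rmonoid_scheme \<Rightarrow> 'a set \<Rightarrow> 'a" where
  "tau S C = (THE m. is_max S C m)"

section \<open>Free restriction monoids\<close>

datatype 'a rterm = Gen 'a | One | Mul "'a rterm" "'a rterm" | Star "'a rterm" | Plus "'a rterm"

definition term_alg :: "'a set \<Rightarrow> 'a rterm rmonoid" where
  "term_alg A = \<lparr>carrier = {t. set_rterm t \<subseteq> A}, mult = Mul, one = One, rstar = Star, rplus = Plus\<rparr>"

text \<open>The least congruence on the term algebra whose quotient is a restriction monoid,
  i.e. two terms are related iff their equality follows from the axioms.\<close>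

definition free_cong :: "'a set \<Rightarrow> 'a rterm rel" where
  "free_cong A = \<Inter>{r. congruence (term_alg A) r \<and> restriction_monoid (quot (term_alg A) r)}"

definition FR :: "'a set \<Rightarrow> 'a rterm set rmonoid" where
  "FR A = quot (term_alg A) (free_cong A)"

definition fgen :: "'a set \<Rightarrow> 'a \<Rightarrow> 'a rterm set" where
  "fgen A a = free_cong A `` {Gen a}"

text \<open>The image of \<open>p\<close> under the morphism \<open>FR A \<rightarrow> S\<close> extending \<open>g\<close>
  (see \<open>free_ext_unique\<close>).\<close>

definition free_ext :: "'a set \<Rightarrow> ('b, 'e) rmonoid_scheme \<Rightarrow> ('a \<Rightarrow> 'b) \<Rightarrow> 'a rterm set \<Rightarrow> 'b" where
  "free_ext A S g p =
     (THE y. \<exists>h\<in>rm_hom (FR A) S. (\<forall>a\<in>A. h (fgen A a) = g a) \<and> y = h p)"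

section \<open>Identities\<close>

definition free_monoid :: "'x set \<Rightarrow> 'x list monoid" where
  "free_monoid X = \<lparr>carrier = lists X, mult = (@), one = []\<rparr>"

definition word_ext :: "('m, 'c) monoid_scheme \<Rightarrow> ('x \<Rightarrow> 'm) \<Rightarrow> 'x list \<Rightarrow> 'm" where
  "word_ext M f u = foldr (\<lambda>x m. f x \<otimes>\<^bsub>M\<^esub> m) u \<one>\<^bsub>M\<^esub>"

definition identity_value ::
  "'x set \<Rightarrow> ('m, 'c) monoid_scheme \<Rightarrow> ('s, 'd) rmonoid_scheme \<Rightarrow> ('m \<Rightarrow> 's) \<Rightarrow> ('x \<Rightarrow> 'm)
     \<Rightarrow> 'x list rterm set \<Rightarrow> 's" where
  "identity_value X M S \<gamma> f p = free_ext (lists X) S (\<lambda>u. \<gamma> (word_ext M f u)) p"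

type_synonym 'x ident = "'x list rterm set \<times> 'x list rterm set"

definition identities :: "'x set \<Rightarrow> 'x ident set" where
  "identities X = carrier (FR (lists X)) \<times> carrier (FR (lists X))"

definition satisfies ::
  "'x set \<Rightarrow> ('m, 'c) monoid_scheme \<Rightarrow> ('s, 'd) rmonoid_scheme \<Rightarrow> ('m \<Rightarrow> 's) \<Rightarrow> 'x ident \<Rightarrow> bool" where
  "satisfies X M S \<gamma> e \<longleftrightarrow> (\<forall>f \<in> X \<rightarrow> carrier M.
     identity_value X M S \<gamma> f (fst e) = identity_value X M S \<gamma> f (snd e))"

text \<open>HOL cannot quantify over types inside a definition. The carriers here range over two
  types determined by \<open>'x\<close>, which are large enough: \<open>admissible_satisfies\<close> below shows that an
  admissible identity is satisfied by the monoid morphisms between structures over arbitrary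
  types.\<close>

definition admissible :: "'x set \<Rightarrow> 'x ident \<Rightarrow> bool" where
  "admissible X e \<longleftrightarrow>
     (\<forall>(M :: 'x list monoid) (S :: 'x list rterm set set rmonoid) \<gamma>.
        monoid M \<and> restriction_monoid S \<and> \<gamma> \<in> mon_hom M S \<longrightarrow> satisfies X M S \<gamma> e)"

section \<open>The restriction monoid \<open>FR\<^sub>R(M)\<close>\<close>

definition FRR_rels :: "'x set \<Rightarrow> 'x ident set \<Rightarrow> ('m, 'c) monoid_scheme \<Rightarrow> 'm rterm set rel" where
  "FRR_rels X R M = (let F = FR (carrier M); g = fgen (carrier M) in
     {(g \<one>\<^bsub>M\<^esub>, \<one>\<^bsub>F\<^esub>)}
     \<union> {(g m \<otimes>\<^bsub>F\<^esub> g n, g (m \<otimes>\<^bsub>M\<^esub> n) \<otimes>\<^bsub>F\<^esub> rstar F (g m \<otimes>\<^bsub>F\<^esub> g n)) | m n.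
          m \<in> carrier M \<and> n \<in> carrier M}
     \<union> {(identity_value X M F g f p, identity_value X M F g f q) | p q f.
          (p, q) \<in> R \<and> f \<in> X \<rightarrow> carrier M})"

definition FRR_cong :: "'x set \<Rightarrow> 'x ident set \<Rightarrow> ('m, 'c) monoid_scheme \<Rightarrow> 'm rterm set rel" where
  "FRR_cong X R M = cong_gen (FR (carrier M)) (FRR_rels X R M)"

definition FRR :: "'x set \<Rightarrow> 'x ident set \<Rightarrow> ('m, 'c) monoid_scheme \<Rightarrow> 'm rterm set set rmonoid" where
  "FRR X R M = quot (FR (carrier M)) (FRR_cong X R M)"

definition iota :: "'x set \<Rightarrow> 'x ident set \<Rightarrow> ('m, 'c) monoid_scheme \<Rightarrow> 'm \<Rightarrow> 'm rterm set set" where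
  "iota X R M m = FRR_cong X R M `` {fgen (carrier M) m}"

text \<open>The morphism \<open>p\<^sub>M\<close> and the map \<open>FRR / \<sigma> \<rightarrow> M\<close> it induces; for admissible identities both are
  well defined (\<open>proj_hom\<close>, \<open>proj_iota\<close>, \<open>kernel_proj\<close>, \<open>proj_M_bar_iso\<close> below).\<close>

definition proj_M :: "'x set \<Rightarrow> 'x ident set \<Rightarrow> ('m, 'c) monoid_scheme \<Rightarrow> 'm rterm set set \<Rightarrow> 'm" where
  "proj_M X R M a = (THE y. \<exists>h\<in>rm_hom (FRR X R M) (reduced M).
     (\<forall>m\<in>carrier M. h (iota X R M m) = m) \<and> y = h a)"

definition proj_M_bar ::
  "'x set \<Rightarrow> 'x ident set \<Rightarrow> ('m, 'c) monoid_scheme \<Rightarrow> 'm rterm set set set \<Rightarrow> 'm" where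
  "proj_M_bar X R M C = the_elem (proj_M X R M ` C)"

section \<open>Well-definedness of the constructions\<close>

locale rm_algebra =
  fixes S :: "('a, 'e) rmonoid_scheme" (structure)
  assumes alg_closed [simp]:
    "\<lbrakk>x \<in> carrier S; y \<in> carrier S\<rbrakk> \<Longrightarrow> x \<otimes> y \<in> carrier S"
    "\<one> \<in> carrier S"
    "x \<in> carrier S \<Longrightarrow> rstar S x \<in> carrier S"
    "x \<in> carrier S \<Longrightarrow> rplus S x \<in> carrier S"
begin

lemma congruence_total: "congruence S (carrier S \<times> carrier S)"
  by (auto simp: congruence_def equiv_def refl_on_def sym_def trans_def)

lemma congruence_Inter:
  assumes "\<And>r. r \<in> \<R> \<Longrightarrow> congruence S r" "\<R> \<noteq> {}"
  shows "congruence S (\<Inter>\<R>)"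
proof -
  have e: "refl_on (carrier S) r" "sym r" "trans r" "r \<subseteq> carrier S \<times> carrier S" if "r \<in> \<R>" for r
    using assms(1)[OF that] by (auto simp: congruence_def equiv_def)
  have "equiv (carrier S) (\<Inter>\<R>)"
    unfolding equiv_def
  proof (intro conjI)
    show "\<Inter>\<R> \<subseteq> carrier S \<times> carrier S" using assms(2) e(4) by blast
    show "refl_on (carrier S) (\<Inter>\<R>)" using e(1) by (auto simp: refl_on_def)
    show "sym (\<Inter>\<R>)" using e(2) by (auto simp: sym_def)
    show "trans (\<Inter>\<R>)" using e(3) unfolding trans_def by blast
  qed
  moreover have "(a \<otimes> c, b \<otimes> d) \<in> \<Inter>\<R>" if "(a, b) \<in> \<Inter>\<R>" "(c, d) \<in> \<Inter>\<R>" for a b c d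
    using assms(1) that unfolding congruence_def by blast
  moreover have "(rstar S a, rstar S b) \<in> \<Inter>\<R> \<and> (rplus S a, rplus S b) \<in> \<Inter>\<R>"
    if "(a, b) \<in> \<Inter>\<R>" for a b
    using assms(1) that unfolding congruence_def by blast
  ultimately show ?thesis by (auto simp: congruence_def)
qed

lemma congruence_gen:
  assumes "E \<subseteq> carrier S \<times> carrier S"
  shows "congruence S (cong_gen S E)"
  unfolding cong_gen_def using assms congruence_total by (intro congruence_Inter) auto

end

lemma cong_gen_incl: "E \<subseteq> cong_gen S E"
  by (auto simp: cong_gen_def)

lemma cong_gen_least: "congruence S r \<Longrightarrow> E \<subseteq> r \<Longrightarrow> cong_gen S E \<subseteq> r"
  by (auto simp: cong_gen_def)

locale rm_congruence = rm_algebra S for S :: "('a, 'e) rmonoid_scheme" (structure) +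
  fixes r
  assumes cong: "congruence S r"
begin

lemma eqv: "equiv (carrier S) r"
  using cong by (simp add: congruence_def)

lemma in_carrier: "(a, b) \<in> r \<Longrightarrow> a \<in> carrier S \<and> b \<in> carrier S"
  using eqv by (auto simp: equiv_def)

lemma quot_carrier: "carrier (quot S r) = (\<lambda>a. r `` {a}) ` carrier S"
  by (auto simp: quot_def quotient_def)

lemma class_eq [simp]:
  "a \<in> carrier S \<Longrightarrow> b \<in> carrier S \<Longrightarrow> r `` {a} = r `` {b} \<longleftrightarrow> (a, b) \<in> r"
  using eq_equiv_class_iff[OF eqv] .

lemma cong_refl [simp]: "a \<in> carrier S \<Longrightarrow> (a, a) \<in> r"
  using eqv by (auto simp: equiv_def refl_on_def)

lemma quot_one [simp]: "\<one>\<^bsub>quot S r\<^esub> = r `` {\<one>}"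
  by (simp add: quot_def)

lemma quot_star [simp]:
  assumes "a \<in> carrier S"
  shows "rstar (quot S r) (r `` {a}) = r `` {rstar S a}"
proof -
  have "r `` {rstar S b} = r `` {rstar S a}" if "b \<in> r `` {a}" for b
  proof -
    have "(rstar S a, rstar S b) \<in> r" using that cong by (auto simp: congruence_def)
    then show ?thesis using equiv_class_eq[OF eqv] by metis
  qed
  moreover have "a \<in> r `` {a}" using assms by simp
  ultimately show ?thesis
    unfolding quot_def rmonoid.simps by (intro UN_constant_eq[where a = a] ballI)
qed

lemma quot_plus [simp]:
  assumes "a \<in> carrier S"
  shows "rplus (quot S r) (r `` {a}) = r `` {rplus S a}"
proof -
  have "r `` {rplus S b} = r `` {rplus S a}" if "b \<in> r `` {a}" for b
  proof -
    have "(rplus S a, rplus S b) \<in> r" using that cong by (auto simp: congruence_def)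
    then show ?thesis using equiv_class_eq[OF eqv] by metis
  qed
  moreover have "a \<in> r `` {a}" using assms by simp
  ultimately show ?thesis
    unfolding quot_def rmonoid.simps by (intro UN_constant_eq[where a = a] ballI)
qed

lemma quot_mult [simp]:
  assumes "a \<in> carrier S" "b \<in> carrier S"
  shows "r `` {a} \<otimes>\<^bsub>quot S r\<^esub> r `` {b} = r `` {a \<otimes> b}"
proof -
  have "r `` {c \<otimes> d} = r `` {a \<otimes> b}" if "c \<in> r `` {a}" "d \<in> r `` {b}" for c d
  proof -
    have "(a \<otimes> b, c \<otimes> d) \<in> r" using that cong by (auto simp: congruence_def)
    then show ?thesis using equiv_class_eq[OF eqv] by metis
  qed
  moreover have "a \<in> r `` {a}" "b \<in> r `` {b}" using assms by simp_all
  ultimately show ?thesis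
    unfolding quot_def monoid.simps
    by (intro UN_constant_eq[where a = a] UN_constant_eq[where a = b] ballI)
qed

lemma restriction_monoid_quot_iff:
  "restriction_monoid (quot S r) \<longleftrightarrow>
    (\<forall>x\<in>carrier S. \<forall>y\<in>carrier S. \<forall>z\<in>carrier S.
       ((x \<otimes> y) \<otimes> z, x \<otimes> (y \<otimes> z)) \<in> r
     \<and> (\<one> \<otimes> x, x) \<in> r \<and> (x \<otimes> \<one>, x) \<in> r
     \<and> (rplus S x \<otimes> x, x) \<in> r
     \<and> (rplus S x \<otimes> rplus S y, rplus S y \<otimes> rplus S x) \<in> r
     \<and> (rplus S (rplus S x \<otimes> y), rplus S x \<otimes> rplus S y) \<in> r
     \<and> (x \<otimes> rplus S y, rplus S (x \<otimes> y) \<otimes> x) \<in> r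
     \<and> (x \<otimes> rstar S x, x) \<in> r
     \<and> (rstar S x \<otimes> rstar S y, rstar S y \<otimes> rstar S x) \<in> r
     \<and> (rstar S (x \<otimes> rstar S y), rstar S x \<otimes> rstar S y) \<in> r
     \<and> (rstar S x \<otimes> y, y \<otimes> rstar S (x \<otimes> y)) \<in> r
     \<and> (rstar S (rplus S x), rplus S x) \<in> r
     \<and> (rplus S (rstar S x), rstar S x) \<in> r)" (is "_ \<longleftrightarrow> ?R")
proof
  assume "restriction_monoid (quot S r)"
  then interpret Q: restriction_monoid "quot S r" .
  have c: "r `` {x} \<in> carrier (quot S r)" if "x \<in> carrier S" for x
    using that by (auto simp: quot_carrier)
  show ?R
  proof (intro ballI)
    fix x y z assume a: "x \<in> carrier S" "y \<in> carrier S" "z \<in> carrier S"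
    note c = c[OF a(1)] c[OF a(2)] c[OF a(3)]
    show "((x \<otimes> y) \<otimes> z, x \<otimes> (y \<otimes> z)) \<in> r
     \<and> (\<one> \<otimes> x, x) \<in> r \<and> (x \<otimes> \<one>, x) \<in> r
     \<and> (rplus S x \<otimes> x, x) \<in> r
     \<and> (rplus S x \<otimes> rplus S y, rplus S y \<otimes> rplus S x) \<in> r
     \<and> (rplus S (rplus S x \<otimes> y), rplus S x \<otimes> rplus S y) \<in> r
     \<and> (x \<otimes> rplus S y, rplus S (x \<otimes> y) \<otimes> x) \<in> r
     \<and> (x \<otimes> rstar S x, x) \<in> r
     \<and> (rstar S x \<otimes> rstar S y, rstar S y \<otimes> rstar S x) \<in> r
     \<and> (rstar S (x \<otimes> rstar S y), rstar S x \<otimes> rstar S y) \<in> r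
     \<and> (rstar S x \<otimes> y, y \<otimes> rstar S (x \<otimes> y)) \<in> r
     \<and> (rstar S (rplus S x), rplus S x) \<in> r
     \<and> (rplus S (rstar S x), rstar S x) \<in> r"
      apply (intro conjI)
      subgoal using Q.mult_assoc[OF c] by (simp only: a quot_mult quot_one quot_star quot_plus class_eq alg_closed)
      subgoal using Q.l_one[OF c(1)] by (simp only: a quot_mult quot_one quot_star quot_plus class_eq alg_closed)
      subgoal using Q.r_one[OF c(1)] by (simp only: a quot_mult quot_one quot_star quot_plus class_eq alg_closed)
      subgoal using Q.rplus_left[OF c(1)] by (simp only: a quot_mult quot_one quot_star quot_plus class_eq alg_closed)
      subgoal using Q.rplus_comm[OF c(1,2)] by (simp only: a quot_mult quot_one quot_star quot_plus class_eq alg_closed)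
      subgoal using Q.rplus_mult[OF c(1,2)] by (simp only: a quot_mult quot_one quot_star quot_plus class_eq alg_closed)
      subgoal using Q.rplus_ample[OF c(1,2)] by (simp only: a quot_mult quot_one quot_star quot_plus class_eq alg_closed)
      subgoal using Q.rstar_right[OF c(1)] by (simp only: a quot_mult quot_one quot_star quot_plus class_eq alg_closed)
      subgoal using Q.rstar_comm[OF c(1,2)] by (simp only: a quot_mult quot_one quot_star quot_plus class_eq alg_closed)
      subgoal using Q.rstar_mult[OF c(1,2)] by (simp only: a quot_mult quot_one quot_star quot_plus class_eq alg_closed)
      subgoal using Q.rstar_ample[OF c(1,2)] by (simp only: a quot_mult quot_one quot_star quot_plus class_eq alg_closed)
      subgoal using Q.rstar_rplus[OF c(1)] by (simp only: a quot_mult quot_one quot_star quot_plus class_eq alg_closed)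
      subgoal using Q.rplus_rstar[OF c(1)] by (simp only: a quot_mult quot_one quot_star quot_plus class_eq alg_closed)
      done
  qed
next
  assume R: ?R
  have R1: "((x \<otimes> y) \<otimes> z, x \<otimes> (y \<otimes> z)) \<in> r"
    if "x \<in> carrier S" "y \<in> carrier S" "z \<in> carrier S" for x y z
    using R[rule_format, OF that] by (elim conjE)
  have R2:
    "(rplus S x \<otimes> rplus S y, rplus S y \<otimes> rplus S x) \<in> r"
    "(rplus S (rplus S x \<otimes> y), rplus S x \<otimes> rplus S y) \<in> r"
    "(x \<otimes> rplus S y, rplus S (x \<otimes> y) \<otimes> x) \<in> r"
    "(rstar S x \<otimes> rstar S y, rstar S y \<otimes> rstar S x) \<in> r"
    "(rstar S (x \<otimes> rstar S y), rstar S x \<otimes> rstar S y) \<in> r"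
    "(rstar S x \<otimes> y, y \<otimes> rstar S (x \<otimes> y)) \<in> r"
    if "x \<in> carrier S" "y \<in> carrier S" for x y
    using R[rule_format, OF that(1,2,2)] by auto
  have R3: "(\<one> \<otimes> x, x) \<in> r" "(x \<otimes> \<one>, x) \<in> r"
    "(rplus S x \<otimes> x, x) \<in> r" "(x \<otimes> rstar S x, x) \<in> r"
    "(rstar S (rplus S x), rplus S x) \<in> r" "(rplus S (rstar S x), rstar S x) \<in> r"
    if "x \<in> carrier S" for x
    using R[rule_format, OF that that that] by auto
  have ex: "\<exists>a\<in>carrier S. C = r `` {a}" if "C \<in> carrier (quot S r)" for C
    using that by (auto simp: quot_carrier)
  have car [simp]: "a \<in> carrier S \<Longrightarrow> r `` {a} \<in> carrier (quot S r)" for a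
    by (auto simp: quot_carrier)
  show "restriction_monoid (quot S r)"
  proof (intro restriction_monoid.intro restriction_semigroup.intro monoid.intro)
    fix x assume x: "x \<in> carrier (quot S r)"
    obtain a where [simp]: "a \<in> carrier S" "x = r `` {a}" using ex[OF x] by blast
    show "rstar (quot S r) x \<in> carrier (quot S r)" "rplus (quot S r) x \<in> carrier (quot S r)"
      "\<one>\<^bsub>quot S r\<^esub> \<otimes>\<^bsub>quot S r\<^esub> x = x" "x \<otimes>\<^bsub>quot S r\<^esub> \<one>\<^bsub>quot S r\<^esub> = x"
      "rplus (quot S r) x \<otimes>\<^bsub>quot S r\<^esub> x = x" "x \<otimes>\<^bsub>quot S r\<^esub> rstar (quot S r) x = x"
      "rstar (quot S r) (rplus (quot S r) x) = rplus (quot S r) x"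
      "rplus (quot S r) (rstar (quot S r) x) = rstar (quot S r) x"
      by (simp_all add: R3)
    fix y assume y: "y \<in> carrier (quot S r)"
    obtain b where [simp]: "b \<in> carrier S" "y = r `` {b}" using ex[OF y] by blast
    show "x \<otimes>\<^bsub>quot S r\<^esub> y \<in> carrier (quot S r)" "x \<otimes>\<^bsub>quot S r\<^esub> y \<in> carrier (quot S r)"
      "rplus (quot S r) x \<otimes>\<^bsub>quot S r\<^esub> rplus (quot S r) y = rplus (quot S r) y \<otimes>\<^bsub>quot S r\<^esub> rplus (quot S r) x"
      "rplus (quot S r) (rplus (quot S r) x \<otimes>\<^bsub>quot S r\<^esub> y) = rplus (quot S r) x \<otimes>\<^bsub>quot S r\<^esub> rplus (quot S r) y"
      "x \<otimes>\<^bsub>quot S r\<^esub> rplus (quot S r) y = rplus (quot S r) (x \<otimes>\<^bsub>quot S r\<^esub> y) \<otimes>\<^bsub>quot S r\<^esub> x"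
      "rstar (quot S r) x \<otimes>\<^bsub>quot S r\<^esub> rstar (quot S r) y = rstar (quot S r) y \<otimes>\<^bsub>quot S r\<^esub> rstar (quot S r) x"
      "rstar (quot S r) (x \<otimes>\<^bsub>quot S r\<^esub> rstar (quot S r) y) = rstar (quot S r) x \<otimes>\<^bsub>quot S r\<^esub> rstar (quot S r) y"
      "rstar (quot S r) x \<otimes>\<^bsub>quot S r\<^esub> y = y \<otimes>\<^bsub>quot S r\<^esub> rstar (quot S r) (x \<otimes>\<^bsub>quot S r\<^esub> y)"
      by (simp_all add: R2)
    fix z assume z: "z \<in> carrier (quot S r)"
    obtain c where [simp]: "c \<in> carrier S" "z = r `` {c}" using ex[OF z] by blast
    show "x \<otimes>\<^bsub>quot S r\<^esub> y \<otimes>\<^bsub>quot S r\<^esub> z = x \<otimes>\<^bsub>quot S r\<^esub> (y \<otimes>\<^bsub>quot S r\<^esub> z)"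
      "x \<otimes>\<^bsub>quot S r\<^esub> y \<otimes>\<^bsub>quot S r\<^esub> z = x \<otimes>\<^bsub>quot S r\<^esub> (y \<otimes>\<^bsub>quot S r\<^esub> z)"
      by (simp_all add: R1)
  qed simp
qed

lemma class_hom: "(\<lambda>a. r `` {a}) \<in> rm_hom S (quot S r)"
  by (auto simp: rm_hom_def mon_hom_def hom_def quot_carrier)

lemma quot_lift:
  assumes h: "h \<in> rm_hom S T" and ker: "\<And>a b. (a, b) \<in> r \<Longrightarrow> h a = h b"
  shows "\<exists>k\<in>rm_hom (quot S r) T. \<forall>a\<in>carrier S. k (r `` {a}) = h a"
proof -
  define k where "k C = the_elem (h ` C)" for C
  have k: "k (r `` {a}) = h a" if "a \<in> carrier S" for a
  proof -
    have "a \<in> r `` {a}" using that by simp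
    moreover have "h b = h a" if "b \<in> r `` {a}" for b using that ker by auto
    ultimately have "h ` (r `` {a}) = {h a}" by blast
    then show ?thesis by (simp add: k_def)
  qed
  have "k \<in> rm_hom (quot S r) T"
    using h by (auto simp: rm_hom_def mon_hom_def hom_def quot_carrier k)
  with k show ?thesis by blast
qed

end

lemma (in restriction_monoid) is_rm_algebra: "rm_algebra S"
  by (rule rm_algebra.intro) (rule mult_closed one_closed rstar_closed rplus_closed; assumption)+

lemma restriction_monoid_quot:
  assumes "restriction_monoid S" "congruence S r"
  shows "restriction_monoid (quot S r)"
proof -
  interpret restriction_monoid S by fact
  interpret rm_congruence S r
    using assms(2) is_rm_algebra by (simp add: rm_congruence_def rm_congruence_axioms_def)
  have eqI: "(x, y) \<in> r" if "x = y" "x \<in> carrier S" for x y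
    using that by simp
  show ?thesis unfolding restriction_monoid_quot_iff
  proof (intro ballI)
    fix x y z assume a: "x \<in> carrier S" "y \<in> carrier S" "z \<in> carrier S"
    show "((x \<otimes>\<^bsub>S\<^esub> y) \<otimes>\<^bsub>S\<^esub> z, x \<otimes>\<^bsub>S\<^esub> (y \<otimes>\<^bsub>S\<^esub> z)) \<in> r
     \<and> (\<one>\<^bsub>S\<^esub> \<otimes>\<^bsub>S\<^esub> x, x) \<in> r \<and> (x \<otimes>\<^bsub>S\<^esub> \<one>\<^bsub>S\<^esub>, x) \<in> r
     \<and> (rplus S x \<otimes>\<^bsub>S\<^esub> x, x) \<in> r
     \<and> (rplus S x \<otimes>\<^bsub>S\<^esub> rplus S y, rplus S y \<otimes>\<^bsub>S\<^esub> rplus S x) \<in> r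
     \<and> (rplus S (rplus S x \<otimes>\<^bsub>S\<^esub> y), rplus S x \<otimes>\<^bsub>S\<^esub> rplus S y) \<in> r
     \<and> (x \<otimes>\<^bsub>S\<^esub> rplus S y, rplus S (x \<otimes>\<^bsub>S\<^esub> y) \<otimes>\<^bsub>S\<^esub> x) \<in> r
     \<and> (x \<otimes>\<^bsub>S\<^esub> rstar S x, x) \<in> r
     \<and> (rstar S x \<otimes>\<^bsub>S\<^esub> rstar S y, rstar S y \<otimes>\<^bsub>S\<^esub> rstar S x) \<in> r
     \<and> (rstar S (x \<otimes>\<^bsub>S\<^esub> rstar S y), rstar S x \<otimes>\<^bsub>S\<^esub> rstar S y) \<in> r
     \<and> (rstar S x \<otimes>\<^bsub>S\<^esub> y, y \<otimes>\<^bsub>S\<^esub> rstar S (x \<otimes>\<^bsub>S\<^esub> y)) \<in> r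
     \<and> (rstar S (rplus S x), rplus S x) \<in> r
     \<and> (rplus S (rstar S x), rstar S x) \<in> r"
      by (intro conjI eqI mult_assoc l_one r_one rplus_left rplus_comm rplus_mult rplus_ample
          rstar_right rstar_comm rstar_mult rstar_ample rstar_rplus rplus_rstar
          mult_closed one_closed rstar_closed rplus_closed a)
  qed
qed

lemma rm_homD:
  assumes "h \<in> rm_hom S T"
  shows "x \<in> carrier S \<Longrightarrow> h x \<in> carrier T"
    "x \<in> carrier S \<Longrightarrow> y \<in> carrier S \<Longrightarrow> h (x \<otimes>\<^bsub>S\<^esub> y) = h x \<otimes>\<^bsub>T\<^esub> h y"
    "h \<one>\<^bsub>S\<^esub> = \<one>\<^bsub>T\<^esub>"
    "x \<in> carrier S \<Longrightarrow> h (rstar S x) = rstar T (h x)"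
    "x \<in> carrier S \<Longrightarrow> h (rplus S x) = rplus T (h x)"
  using assms by (auto simp: rm_hom_def mon_hom_def hom_def)

lemma rm_hom_comp:
  assumes "h \<in> rm_hom S T" "k \<in> rm_hom T U"
  shows "(\<lambda>x. k (h x)) \<in> rm_hom S U"
  using assms by (auto simp: rm_hom_def mon_hom_def hom_def Pi_iff)

lemma (in rm_algebra) congruence_kernel:
  assumes "h \<in> rm_hom S T"
  shows "congruence S {(a, b). a \<in> carrier S \<and> b \<in> carrier S \<and> h a = h b}"
  using assms by (auto simp: congruence_def equiv_def refl_on_def sym_def trans_def rm_homD)

interpretation term_alg: rm_algebra "term_alg A" for A
  by unfold_locales (auto simp: term_alg_def)

lemma term_alg_carrier: "t \<in> carrier (term_alg A) \<longleftrightarrow> set_rterm t \<subseteq> A"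
  by (simp add: term_alg_def)

lemma free_cong_congruence: "congruence (term_alg A) (free_cong A)"
  and FR_restriction_monoid: "restriction_monoid (FR A)"
proof -
  let ?T = "term_alg A"
  let ?\<R> = "{r. congruence ?T r \<and> restriction_monoid (quot ?T r)}"
  have "rm_congruence ?T (carrier ?T \<times> carrier ?T)"
    by unfold_locales (rule term_alg.congruence_total)
  then have "carrier ?T \<times> carrier ?T \<in> ?\<R>"
    using term_alg.congruence_total[of A]
    by (simp add: rm_congruence.restriction_monoid_quot_iff)
  then show c: "congruence ?T (free_cong A)"
    unfolding free_cong_def by (intro term_alg.congruence_Inter) auto
  then interpret rm_congruence ?T "free_cong A" by unfold_locales
  have q: "rm_congruence ?T r" if "r \<in> ?\<R>" for r
    using that by unfold_locales auto
  note * = rm_congruence.restriction_monoid_quot_iff[OF q, THEN iffD1]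
  show "restriction_monoid (FR A)"
    unfolding FR_def restriction_monoid_quot_iff
    using * unfolding free_cong_def Inter_iff by (smt (verit) mem_Collect_eq)
qed

interpretation free_cong: rm_congruence "term_alg A" "free_cong A" for A
  by unfold_locales (rule free_cong_congruence)

interpretation FR: restriction_monoid "FR A" for A
  by (rule FR_restriction_monoid)

lemma fgen_closed: "a \<in> A \<Longrightarrow> fgen A a \<in> carrier (FR A)"
  by (auto simp: fgen_def FR_def free_cong.quot_carrier term_alg_carrier)

lemma FR_induct [consumes 1, case_names gen one mult star plus]:
  assumes "p \<in> carrier (FR A)"
    and gen: "\<And>a. a \<in> A \<Longrightarrow> P (fgen A a)"
    and one: "P \<one>\<^bsub>FR A\<^esub>"
    and mult: "\<And>p q. \<lbrakk>p \<in> carrier (FR A); q \<in> carrier (FR A); P p; P q\<rbrakk> \<Longrightarrow> P (p \<otimes>\<^bsub>FR A\<^esub> q)"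
    and star: "\<And>p. \<lbrakk>p \<in> carrier (FR A); P p\<rbrakk> \<Longrightarrow> P (rstar (FR A) p)"
    and plus: "\<And>p. \<lbrakk>p \<in> carrier (FR A); P p\<rbrakk> \<Longrightarrow> P (rplus (FR A) p)"
  shows "P p"
proof -
  let ?c = "\<lambda>t. free_cong A `` {t}"
  have cl: "?c t \<in> carrier (FR A)" if "t \<in> carrier (term_alg A)" for t
    using that by (auto simp: FR_def free_cong.quot_carrier)
  note h = rm_homD[OF free_cong.class_hom[of A], folded FR_def]
  have "t \<in> carrier (term_alg A) \<Longrightarrow> P (?c t)" for t
  proof (induction t)
    case (Gen a)
    then show ?case using gen by (simp add: fgen_def term_alg_def)
  next
    case One
    then show ?case using one h(3) by (simp add: term_alg_def)
  next
    case (Mul t u)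
    then have "t \<in> carrier (term_alg A)" "u \<in> carrier (term_alg A)" by (auto simp: term_alg_def)
    then show ?case using mult[OF cl cl] Mul h(2)[of t u] by (simp add: term_alg_def)
  next
    case (Star t)
    then have "t \<in> carrier (term_alg A)" by (auto simp: term_alg_def)
    then show ?case using star[OF cl] Star h(4)[of t] by (simp add: term_alg_def)
  next
    case (Plus t)
    then have "t \<in> carrier (term_alg A)" by (auto simp: term_alg_def)
    then show ?case using plus[OF cl] Plus h(5)[of t] by (simp add: term_alg_def)
  qed
  with assms(1) show ?thesis by (auto simp: FR_def free_cong.quot_carrier)
qed

lemma free_ext_unique:
  assumes "h \<in> rm_hom (FR A) S" "k \<in> rm_hom (FR A) S" "\<And>a. a \<in> A \<Longrightarrow> h (fgen A a) = k (fgen A a)"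
    and "p \<in> carrier (FR A)"
  shows "h p = k p"
  using assms(4) by (induction rule: FR_induct) (simp_all add: assms(3) rm_homD[OF assms(1)] rm_homD[OF assms(2)])

lemma free_ext_exists:
  assumes "restriction_monoid S" and g: "\<And>a. a \<in> A \<Longrightarrow> g a \<in> carrier S"
  shows "\<exists>h\<in>rm_hom (FR A) S. \<forall>a\<in>A. h (fgen A a) = g a"
proof -
  interpret S: restriction_monoid S by fact
  define ev where "ev = rec_rterm g \<one>\<^bsub>S\<^esub> (\<lambda>_ _ x y. x \<otimes>\<^bsub>S\<^esub> y) (\<lambda>_. rstar S) (\<lambda>_. rplus S)"
  have ev_car: "t \<in> carrier (term_alg A) \<Longrightarrow> ev t \<in> carrier S" for t
    by (induction t) (auto simp: term_alg_def ev_def g S.rstar_closed S.rplus_closed)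
  have ev: "ev \<in> rm_hom (term_alg A) S"
    using ev_car by (auto simp: rm_hom_def mon_hom_def hom_def) (auto simp: term_alg_def ev_def)
  let ?T = "term_alg A"
  let ?k = "{(a, b). a \<in> carrier ?T \<and> b \<in> carrier ?T \<and> ev a = ev b}"
  have ck: "congruence ?T ?k" using ev by (rule term_alg.congruence_kernel)
  then interpret k: rm_congruence ?T ?k by unfold_locales
  note ax = S.mult_assoc S.rplus_left S.rplus_mult S.rplus_ample[symmetric]
    S.rstar_right S.rstar_mult S.rstar_ample[symmetric] S.rstar_rplus S.rplus_rstar
  have "restriction_monoid (quot ?T ?k)"
    unfolding k.restriction_monoid_quot_iff
    by (auto simp: rm_homD[OF ev] ev_car ax intro: S.rplus_comm S.rstar_comm)
  with ck have "free_cong A \<subseteq> ?k" unfolding free_cong_def by blast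
  then obtain h where "h \<in> rm_hom (quot ?T (free_cong A)) S"
      "\<forall>t\<in>carrier ?T. h (free_cong A `` {t}) = ev t"
    using free_cong.quot_lift[OF ev] by blast
  then show ?thesis
    by (intro bexI[of _ h]) (auto simp: FR_def fgen_def term_alg_carrier ev_def)
qed

lemma free_ext_eqI:
  assumes "h \<in> rm_hom (FR A) S" "\<And>a. a \<in> A \<Longrightarrow> h (fgen A a) = g a" "p \<in> carrier (FR A)"
  shows "free_ext A S g p = h p"
  unfolding free_ext_def
proof (rule the_equality)
  show "\<exists>k\<in>rm_hom (FR A) S. (\<forall>a\<in>A. k (fgen A a) = g a) \<and> h p = k p"
    using assms by blast
next
  fix y assume "\<exists>k\<in>rm_hom (FR A) S. (\<forall>a\<in>A. k (fgen A a) = g a) \<and> y = k p"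
  then obtain k where "k \<in> rm_hom (FR A) S" "\<forall>a\<in>A. k (fgen A a) = g a" "y = k p" by blast
  then show "y = h p" using assms by (auto intro: free_ext_unique)
qed

lemma word_ext_closed:
  assumes "monoid M" "f \<in> X \<rightarrow> carrier M" "u \<in> lists X"
  shows "word_ext M f u \<in> carrier M"
proof -
  interpret monoid M by fact
  show ?thesis using assms(3) by (induction u) (use assms(2) in \<open>auto simp: word_ext_def\<close>)
qed

lemma word_ext_append:
  assumes "monoid M" "f \<in> X \<rightarrow> carrier M" "u \<in> lists X" "v \<in> lists X"
  shows "word_ext M f (u @ v) = word_ext M f u \<otimes>\<^bsub>M\<^esub> word_ext M f v"
proof -
  interpret monoid M by fact
  have v: "foldr (\<lambda>x m. f x \<otimes>\<^bsub>M\<^esub> m) v \<one>\<^bsub>M\<^esub> \<in> carrier M"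
    using word_ext_closed[OF assms(1,2,4)] by (simp add: word_ext_def)
  show ?thesis using assms(3)
  proof (induction u)
    case Nil
    then show ?case using v by (simp add: word_ext_def)
  next
    case (Cons x u)
    have "foldr (\<lambda>x m. f x \<otimes>\<^bsub>M\<^esub> m) u \<one>\<^bsub>M\<^esub> \<in> carrier M"
      using word_ext_closed[OF assms(1,2), of u] Cons by (simp add: word_ext_def)
    then show ?case using Cons v assms(2) by (auto simp: word_ext_def m_assoc Pi_iff)
  qed
qed

theorem admissible_satisfies:
  fixes M :: "('m, 'c) monoid_scheme" and S :: "('s, 'd) rmonoid_scheme"
  assumes adm: "admissible X e" and e: "e \<in> identities X"
    and M: "monoid M" and S: "restriction_monoid S" and \<gamma>: "\<gamma> \<in> mon_hom M S"
  shows "satisfies X M S \<gamma> e"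
  unfolding satisfies_def
proof
  fix f assume f: "f \<in> X \<rightarrow> carrier M"
  let ?A = "lists X" and ?F = "FR (lists X)" and ?W = "free_monoid X"
  interpret M: monoid M by fact
  interpret S: restriction_monoid S by fact
  interpret F: rm_algebra ?F by (rule FR.is_rm_algebra)
  have W: "monoid ?W" by unfold_locales (auto simp: free_monoid_def)
  define E where "E = insert (fgen ?A [], \<one>\<^bsub>?F\<^esub>)
    {(fgen ?A u \<otimes>\<^bsub>?F\<^esub> fgen ?A v, fgen ?A (u @ v)) | u v. u \<in> ?A \<and> v \<in> ?A}"
  define r where "r = cong_gen ?F E"
  have "E \<subseteq> carrier ?F \<times> carrier ?F" unfolding E_def by (auto intro!: fgen_closed FR.mult_closed)
  then have r: "congruence ?F r" unfolding r_def by (rule F.congruence_gen)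
  then interpret r: rm_congruence ?F r by unfold_locales
  let ?N = "quot ?F r"
  have N: "restriction_monoid ?N" using r FR_restriction_monoid by (rule restriction_monoid_quot[rotated])
  define \<delta> where "\<delta> u = r `` {fgen ?A u}" for u
  have E: "E \<subseteq> r" unfolding r_def by (rule cong_gen_incl)
  have "\<delta> \<in> mon_hom ?W ?N"
  proof -
    have "\<delta> (u @ v) = \<delta> u \<otimes>\<^bsub>?N\<^esub> \<delta> v" if "u \<in> ?A" "v \<in> ?A" for u v
    proof -
      have uv: "u @ v \<in> ?A" using that by simp
      have "(fgen ?A u \<otimes>\<^bsub>?F\<^esub> fgen ?A v, fgen ?A (u @ v)) \<in> r"
        using E that unfolding E_def by blast
      then show ?thesis
        using that uv by (simp add: \<delta>_def fgen_closed FR.mult_closed equiv_class_eq[OF r.eqv])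
    qed
    moreover have "\<delta> [] = \<one>\<^bsub>?N\<^esub>"
      using E by (simp add: \<delta>_def fgen_closed E_def)
    moreover have "\<delta> u \<in> carrier ?N" if "u \<in> ?A" for u
      using fgen_closed[OF that] by (simp add: \<delta>_def r.quot_carrier)
    ultimately show ?thesis by (auto simp: mon_hom_def hom_def free_monoid_def)
  qed
  with adm W N have sat: "satisfies X ?W ?N \<delta> e" unfolding admissible_def by blast
  have fx: "(\<lambda>x. [x]) \<in> X \<rightarrow> carrier ?W" by (auto simp: free_monoid_def)
  have "word_ext ?W (\<lambda>x. [x]) u = u" for u
    by (induction u) (simp_all add: word_ext_def free_monoid_def)
  then have v: "identity_value X ?W ?N \<delta> (\<lambda>x. [x]) p = r `` {p}" if "p \<in> carrier ?F" for p
    unfolding identity_value_def using that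
    by (intro free_ext_eqI[OF r.class_hom]) (simp_all add: \<delta>_def)
  obtain p q where pq: "e = (p, q)" "p \<in> carrier ?F" "q \<in> carrier ?F"
    using e by (auto simp: identities_def)
  from sat fx have "identity_value X ?W ?N \<delta> (\<lambda>x. [x]) p = identity_value X ?W ?N \<delta> (\<lambda>x. [x]) q"
    unfolding satisfies_def pq fst_conv snd_conv by (rule bspec)
  then have pqr: "(p, q) \<in> r" using v pq(2,3) by simp
  let ?g = "\<lambda>u. \<gamma> (word_ext M f u)"
  have \<gamma>c: "\<gamma> x \<in> carrier S" if "x \<in> carrier M" for x using \<gamma> that by (auto simp: mon_hom_def hom_def)
  have gc: "?g u \<in> carrier S" if "u \<in> ?A" for u
    using word_ext_closed[OF M f that] by (rule \<gamma>c)
  have "\<exists>h\<in>rm_hom ?F S. \<forall>u\<in>?A. h (fgen ?A u) = ?g u"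
    using gc by (intro free_ext_exists[OF S])
  then obtain h where h: "h \<in> rm_hom ?F S" and hg: "\<forall>u\<in>?A. h (fgen ?A u) = ?g u"
    by (rule bexE)
  note hg = hg[rule_format]
  have g1: "?g [] = \<one>\<^bsub>S\<^esub>" using \<gamma> by (simp add: mon_hom_def word_ext_def)
  have g2: "?g (u @ v) = ?g u \<otimes>\<^bsub>S\<^esub> ?g v" if "u \<in> ?A" "v \<in> ?A" for u v
    using \<gamma> word_ext_closed[OF M f that(1)] word_ext_closed[OF M f that(2)]
    by (simp add: mon_hom_def hom_def word_ext_append[OF M f that])
  let ?k = "{(a, b). a \<in> carrier ?F \<and> b \<in> carrier ?F \<and> h a = h b}"
  have "E \<subseteq> ?k"
  proof -
    have "h (fgen ?A []) = h \<one>\<^bsub>?F\<^esub>" using hg[of "[]"] g1 by (simp add: rm_homD[OF h])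
    moreover have "h (fgen ?A u \<otimes>\<^bsub>?F\<^esub> fgen ?A v) = h (fgen ?A (u @ v))"
      if "u \<in> ?A" "v \<in> ?A" for u v
      using that hg[of u] hg[of v] hg[of "u @ v"] g2[of u v]
      by (simp add: rm_homD[OF h] fgen_closed)
    ultimately have "h a = h b" if "(a, b) \<in> E" for a b
      using that unfolding E_def by blast
    then show ?thesis
      using \<open>E \<subseteq> carrier ?F \<times> carrier ?F\<close> by blast
  qed
  then have "r \<subseteq> ?k" unfolding r_def
    using F.congruence_kernel[OF h] by (intro cong_gen_least)
  with pqr have "h p = h q" by auto
  moreover have "identity_value X M S \<gamma> f a = h a" if "a \<in> carrier ?F" for a
    unfolding identity_value_def using h hg that by (intro free_ext_eqI) auto
  ultimately show "identity_value X M S \<gamma> f (fst e) = identity_value X M S \<gamma> f (snd e)"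
    using pq by simp
qed

lemma free_ext_hom:
  assumes "restriction_monoid S" "\<And>a. a \<in> A \<Longrightarrow> g a \<in> carrier S"
  shows "free_ext A S g \<in> rm_hom (FR A) S" and "a \<in> A \<Longrightarrow> free_ext A S g (fgen A a) = g a"
proof -
  have "\<exists>h\<in>rm_hom (FR A) S. \<forall>a\<in>A. h (fgen A a) = g a"
    using assms by (rule free_ext_exists)
  then obtain h where h: "h \<in> rm_hom (FR A) S" "\<forall>a\<in>A. h (fgen A a) = g a"
    by (rule bexE)
  note h = h(1) h(2)[rule_format]
  have eq: "free_ext A S g p = h p" if "p \<in> carrier (FR A)" for p
    using h that by (rule free_ext_eqI)
  show "free_ext A S g \<in> rm_hom (FR A) S"
    using h(1)
    by (simp add: rm_hom_def mon_hom_def hom_def Pi_iff eq FR.mult_closed FR.rstar_closed FR.rplus_closed)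
  show "free_ext A S g (fgen A a) = g a" if "a \<in> A"
    using that by (simp add: eq h(2) fgen_closed)
qed

lemma reduced_restriction_monoid:
  assumes "monoid M"
  shows "restriction_monoid (reduced M)"
proof -
  interpret monoid M by fact
  show ?thesis by unfold_locales (simp_all add: reduced_def m_assoc)
qed

locale admissible_presentation = M: monoid M
  for M :: "('m, 'c) monoid_scheme" +
  fixes X :: "'x set" and R :: "'x ident set"
  assumes R: "R \<subseteq> identities X" and adm: "\<forall>e\<in>R. admissible X e"
begin

abbreviation "F \<equiv> FR (carrier M)"
abbreviation "G \<equiv> FRR X R M"
abbreviation "\<iota> \<equiv> iota X R M"
abbreviation "\<pi> \<equiv> proj_M X R M"

lemma value_free:
  assumes "restriction_monoid S" "\<gamma> \<in> carrier M \<rightarrow> carrier S" "f \<in> X \<rightarrow> carrier M"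
  shows "identity_value X M S \<gamma> f \<in> rm_hom (FR (lists X)) S"
  unfolding identity_value_def
  by (rule free_ext_hom(1)[OF assms(1)])
    (rule funcset_mem[OF assms(2) word_ext_closed[OF M.monoid_axioms assms(3)]])

lemma rels_carrier: "FRR_rels X R M \<subseteq> carrier F \<times> carrier F"
proof -
  have "identity_value X M F (fgen (carrier M)) f p \<in> carrier F"
    if "f \<in> X \<rightarrow> carrier M" "p \<in> carrier (FR (lists X))" for f p
    by (rule rm_homD(1)[OF value_free[OF FR_restriction_monoid _ that(1)] that(2)])
      (auto simp: fgen_closed)
  moreover have "p \<in> carrier (FR (lists X)) \<and> q \<in> carrier (FR (lists X))" if "(p, q) \<in> R" for p q
    using R that by (auto simp: identities_def)
  ultimately have 1: "{(identity_value X M F (fgen (carrier M)) f p,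
        identity_value X M F (fgen (carrier M)) f q) | p q f. (p, q) \<in> R \<and> f \<in> X \<rightarrow> carrier M}
      \<subseteq> carrier F \<times> carrier F"
    by blast
  have 2: "fgen (carrier M) m \<otimes>\<^bsub>F\<^esub> fgen (carrier M) n \<in> carrier F"
    if "m \<in> carrier M" "n \<in> carrier M" for m n
    using that by (intro FR.mult_closed fgen_closed)
  have 3: "fgen (carrier M) (m \<otimes>\<^bsub>M\<^esub> n) \<otimes>\<^bsub>F\<^esub>
      rstar F (fgen (carrier M) m \<otimes>\<^bsub>F\<^esub> fgen (carrier M) n) \<in> carrier F"
    if "m \<in> carrier M" "n \<in> carrier M" for m n
    using that by (intro FR.mult_closed FR.rstar_closed fgen_closed M.m_closed)
  show ?thesis
    unfolding FRR_rels_def Let_def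
    using 1 2 3 fgen_closed[OF M.one_closed] FR.one_closed[of "carrier M"] by (intro Un_least) blast+
qed

sublocale FRR: rm_congruence F "FRR_cong X R M"
proof -
  interpret rm_algebra F by (rule FR.is_rm_algebra)
  show "rm_congruence F (FRR_cong X R M)"
    by unfold_locales (simp add: FRR_cong_def congruence_gen rels_carrier)
qed

lemma FRR_restriction_monoid: "restriction_monoid G"
  unfolding FRR_def by (intro restriction_monoid_quot FR_restriction_monoid FRR.cong)

sublocale G: restriction_monoid G
  by (rule FRR_restriction_monoid)

sublocale G: rm_algebra G
  by (rule G.is_rm_algebra)

lemma class_hom: "(\<lambda>a. FRR_cong X R M `` {a}) \<in> rm_hom F G"
  unfolding FRR_def by (rule FRR.class_hom)

lemma iota_closed [simp]: "m \<in> carrier M \<Longrightarrow> \<iota> m \<in> carrier G"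
  unfolding iota_def by (rule rm_homD(1)[OF class_hom]) (rule fgen_closed)

lemma rels_eq:
  assumes "(a, b) \<in> FRR_rels X R M"
  shows "FRR_cong X R M `` {a} = FRR_cong X R M `` {b}"
proof -
  have "(a, b) \<in> FRR_cong X R M"
    using assms cong_gen_incl unfolding FRR_cong_def by blast
  then show ?thesis by (rule equiv_class_eq[OF FRR.eqv])
qed

lemma iota_one: "\<iota> \<one>\<^bsub>M\<^esub> = \<one>\<^bsub>G\<^esub>"
proof -
  have "(fgen (carrier M) \<one>\<^bsub>M\<^esub>, \<one>\<^bsub>F\<^esub>) \<in> FRR_rels X R M" by (simp add: FRR_rels_def Let_def)
  from rels_eq[OF this] show ?thesis by (simp add: iota_def FRR_def)
qed

lemma iota_mult:
  assumes "m \<in> carrier M" "n \<in> carrier M"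
  shows "\<iota> m \<otimes>\<^bsub>G\<^esub> \<iota> n = \<iota> (m \<otimes>\<^bsub>M\<^esub> n) \<otimes>\<^bsub>G\<^esub> rstar G (\<iota> m \<otimes>\<^bsub>G\<^esub> \<iota> n)"
proof -
  let ?g = "fgen (carrier M)"
  have "(?g m \<otimes>\<^bsub>F\<^esub> ?g n, ?g (m \<otimes>\<^bsub>M\<^esub> n) \<otimes>\<^bsub>F\<^esub> rstar F (?g m \<otimes>\<^bsub>F\<^esub> ?g n)) \<in> FRR_rels X R M"
    using assms unfolding FRR_rels_def Let_def by blast
  from rels_eq[OF this] show ?thesis
    using assms by (simp add: iota_def FRR_def fgen_closed)
qed

lemma FRR_hom_unique:
  assumes "h \<in> rm_hom G S" "k \<in> rm_hom G S" "\<And>m. m \<in> carrier M \<Longrightarrow> h (\<iota> m) = k (\<iota> m)"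
    and "a \<in> carrier G"
  shows "h a = k a"
proof -
  obtain p where p: "p \<in> carrier F" "a = FRR_cong X R M `` {p}"
    using assms(4) by (auto simp: FRR_def FRR.quot_carrier)
  let ?c = "\<lambda>p. FRR_cong X R M `` {p}"
  have "h (?c p) = k (?c p)"
  proof (rule free_ext_unique[where h = "\<lambda>p. h (?c p)" and k = "\<lambda>p. k (?c p)", OF _ _ _ p(1)])
    show "(\<lambda>p. h (?c p)) \<in> rm_hom F S" by (rule rm_hom_comp[OF class_hom assms(1)])
    show "(\<lambda>p. k (?c p)) \<in> rm_hom F S" by (rule rm_hom_comp[OF class_hom assms(2)])
    show "h (?c (fgen (carrier M) m)) = k (?c (fgen (carrier M) m))" if "m \<in> carrier M" for m
      using assms(3)[OF that] by (simp add: iota_def)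
  qed
  then show ?thesis by (simp add: p(2))
qed

lemma proj_exists: "\<exists>h\<in>rm_hom G (reduced M). \<forall>m\<in>carrier M. h (\<iota> m) = m"
proof -
  let ?N = "reduced M"
  note N = reduced_restriction_monoid[OF M.monoid_axioms]
  have car [simp]: "carrier ?N = carrier M" and ops [simp]: "a \<otimes>\<^bsub>?N\<^esub> b = a \<otimes>\<^bsub>M\<^esub> b"
    "\<one>\<^bsub>?N\<^esub> = \<one>\<^bsub>M\<^esub>" "rstar ?N a = \<one>\<^bsub>M\<^esub>" "rplus ?N a = \<one>\<^bsub>M\<^esub>" for a b
    by (simp_all add: reduced_def)
  have "\<exists>h\<in>rm_hom F ?N. \<forall>m\<in>carrier M. h (fgen (carrier M) m) = m"
    by (rule free_ext_exists[OF N]) simp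
  then obtain h where h: "h \<in> rm_hom F ?N" and hg: "\<forall>m\<in>carrier M. h (fgen (carrier M) m) = m"
    by (rule bexE)
  note hg = hg[rule_format]
  have id: "(\<lambda>m. m) \<in> mon_hom M ?N" by (auto simp: mon_hom_def hom_def)
  let ?k = "{(a, b). a \<in> carrier F \<and> b \<in> carrier F \<and> h a = h b}"
  have val: "h (identity_value X M F (fgen (carrier M)) f p) = identity_value X M ?N (\<lambda>m. m) f p"
    if f: "f \<in> X \<rightarrow> carrier M" and p: "p \<in> carrier (FR (lists X))" for f p
  proof -
    let ?v = "identity_value X M F (fgen (carrier M)) f"
    have v: "?v \<in> rm_hom (FR (lists X)) F"
      by (rule value_free[OF FR_restriction_monoid _ f]) (rule funcsetI, rule fgen_closed)
    have "h (?v (fgen (lists X) u)) = word_ext M f u" if "u \<in> lists X" for u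
    proof -
      have "?v (fgen (lists X) u) = fgen (carrier M) (word_ext M f u)"
        unfolding identity_value_def
        by (rule free_ext_hom(2)[OF FR_restriction_monoid fgen_closed
              [OF word_ext_closed[OF M.monoid_axioms f]] that])
      then show ?thesis using hg[OF word_ext_closed[OF M.monoid_axioms f that]] by simp
    qed
    from free_ext_eqI[OF rm_hom_comp[OF v h] this p]
    have "free_ext (lists X) ?N (word_ext M f) p = h (?v p)" .
    then show ?thesis by (simp add: identity_value_def)
  qed
  have id_eq: "h (identity_value X M F (fgen (carrier M)) f p)
      = h (identity_value X M F (fgen (carrier M)) f q)"
    if f: "f \<in> X \<rightarrow> carrier M" and pq: "(p, q) \<in> R" for f p q
  proof -
    have e: "(p, q) \<in> identities X" using R pq by blast
    have "admissible X (p, q)" using adm pq by blast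
    from admissible_satisfies[OF this e M.monoid_axioms N id] f
    have "identity_value X M ?N (\<lambda>m. m) f p = identity_value X M ?N (\<lambda>m. m) f q"
      by (simp add: satisfies_def)
    then show ?thesis using val[OF f] e by (simp add: identities_def)
  qed
  have "h a = h b" if "(a, b) \<in> FRR_rels X R M" for a b
  proof -
    let ?g = "fgen (carrier M)"
    have "(a, b) = (?g \<one>\<^bsub>M\<^esub>, \<one>\<^bsub>F\<^esub>)
      \<or> (\<exists>m n. (a, b) = (?g m \<otimes>\<^bsub>F\<^esub> ?g n, ?g (m \<otimes>\<^bsub>M\<^esub> n) \<otimes>\<^bsub>F\<^esub> rstar F (?g m \<otimes>\<^bsub>F\<^esub> ?g n))
            \<and> m \<in> carrier M \<and> n \<in> carrier M)
      \<or> (\<exists>p q f. (a, b) = (identity_value X M F ?g f p, identity_value X M F ?g f q)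
            \<and> (p, q) \<in> R \<and> f \<in> X \<rightarrow> carrier M)"
      using that unfolding FRR_rels_def Let_def
      by (simp only: Un_iff mem_Collect_eq singleton_iff disj_assoc)
    then show ?thesis
    proof (elim disjE exE conjE)
      assume "(a, b) = (?g \<one>\<^bsub>M\<^esub>, \<one>\<^bsub>F\<^esub>)"
      then show ?thesis by (simp add: rm_homD[OF h] hg)
    next
      fix m n assume "m \<in> carrier M" "n \<in> carrier M"
        "(a, b) = (?g m \<otimes>\<^bsub>F\<^esub> ?g n, ?g (m \<otimes>\<^bsub>M\<^esub> n) \<otimes>\<^bsub>F\<^esub> rstar F (?g m \<otimes>\<^bsub>F\<^esub> ?g n))"
      then show ?thesis
        by (simp add: rm_homD[OF h] hg fgen_closed FR.mult_closed FR.rstar_closed)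
    next
      fix p q f assume "(p, q) \<in> R" "f \<in> X \<rightarrow> carrier M"
        "(a, b) = (identity_value X M F ?g f p, identity_value X M F ?g f q)"
      then show ?thesis using id_eq[of f p q] by simp
    qed
  qed
  then have "FRR_rels X R M \<subseteq> ?k" using rels_carrier by blast
  then have sub: "FRR_cong X R M \<subseteq> ?k" unfolding FRR_cong_def
    using FRR.congruence_kernel[OF h] by (intro cong_gen_least)
  have "h a = h b" if "(a, b) \<in> FRR_cong X R M" for a b
    using subsetD[OF sub that] by simp
  from FRR.quot_lift[OF h this] obtain k
    where k: "k \<in> rm_hom G ?N" "\<forall>a\<in>carrier F. k (FRR_cong X R M `` {a}) = h a"
    unfolding FRR_def by (rule bexE)
  have "k (\<iota> m) = m" if "m \<in> carrier M" for m
    unfolding iota_def using k(2) fgen_closed[OF that] hg[OF that] by simp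
  with k(1) show ?thesis by (intro bexI ballI)
qed

theorem proj_hom: "\<pi> \<in> rm_hom G (reduced M)"
  and proj_iota: "m \<in> carrier M \<Longrightarrow> \<pi> (\<iota> m) = m"
proof -
  obtain h where h: "h \<in> rm_hom G (reduced M)" and hi: "\<forall>m\<in>carrier M. h (\<iota> m) = m"
    using proj_exists by (rule bexE)
  note hi = hi[rule_format]
  have eq: "\<pi> a = h a" if "a \<in> carrier G" for a
    unfolding proj_M_def
  proof (rule the_equality)
    show "\<exists>k\<in>rm_hom G (reduced M). (\<forall>m\<in>carrier M. k (\<iota> m) = m) \<and> h a = k a"
      by (intro bexI[OF _ h] conjI ballI hi refl)
  next
    fix y assume "\<exists>k\<in>rm_hom G (reduced M). (\<forall>m\<in>carrier M. k (\<iota> m) = m) \<and> y = k a"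
    then obtain k where "k \<in> rm_hom G (reduced M)" "\<forall>m\<in>carrier M. k (\<iota> m) = m" "y = k a" by blast
    then show "y = h a" using FRR_hom_unique[OF _ h _ that, of k] by (simp add: hi)
  qed
  show "\<pi> \<in> rm_hom G (reduced M)"
    using h by (simp add: rm_hom_def mon_hom_def hom_def Pi_iff eq)
  show "\<pi> (\<iota> m) = m" if "m \<in> carrier M"
    using that by (simp add: eq hi)
qed

lemma proj_simps:
  "a \<in> carrier G \<Longrightarrow> \<pi> a \<in> carrier M"
  "a \<in> carrier G \<Longrightarrow> b \<in> carrier G \<Longrightarrow> \<pi> (a \<otimes>\<^bsub>G\<^esub> b) = \<pi> a \<otimes>\<^bsub>M\<^esub> \<pi> b"
  "\<pi> \<one>\<^bsub>G\<^esub> = \<one>\<^bsub>M\<^esub>"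
  "a \<in> carrier G \<Longrightarrow> \<pi> (rstar G a) = \<one>\<^bsub>M\<^esub>"
  "a \<in> carrier G \<Longrightarrow> \<pi> (rplus G a) = \<one>\<^bsub>M\<^esub>"
  using rm_homD[OF proj_hom] by (simp_all add: reduced_def)

lemma projections_carrier: "projections G \<subseteq> carrier G"
  by (auto simp: projections_def)

sublocale sigma: rm_congruence G "sigma G"
  by unfold_locales (use projections_carrier in \<open>auto simp: sigma_def intro!: G.congruence_gen\<close>)

lemma sigma_sym: "sym (sigma G)" and sigma_trans: "trans (sigma G)"
  using sigma.eqv by (simp_all add: equiv_def)

lemma sigma_projections: "e \<in> projections G \<Longrightarrow> f \<in> projections G \<Longrightarrow> (e, f) \<in> sigma G"
  using cong_gen_incl[of "projections G \<times> projections G" G] by (auto simp: sigma_def)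

lemma projections_mem:
  "\<one>\<^bsub>G\<^esub> \<in> projections G"
  "a \<in> carrier G \<Longrightarrow> rstar G a \<in> projections G"
  "a \<in> carrier G \<Longrightarrow> rplus G a \<in> projections G"
proof -
  have "rstar G \<one>\<^bsub>G\<^esub> = \<one>\<^bsub>G\<^esub>" using G.rstar_right[of "\<one>\<^bsub>G\<^esub>"] by (simp add: G.rstar_closed)
  then show "\<one>\<^bsub>G\<^esub> \<in> projections G" unfolding projections_def by (metis G.one_closed imageI)
  show "a \<in> carrier G \<Longrightarrow> rstar G a \<in> projections G" by (simp add: projections_def)
  show "rplus G a \<in> projections G" if "a \<in> carrier G"
    unfolding projections_def
    using G.rstar_rplus[OF that] G.rplus_closed[OF that] by (metis imageI)
qed

lemma sigma_iota_proj:
  assumes "a \<in> carrier G"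
  shows "(a, \<iota> (\<pi> a)) \<in> sigma G"
proof -
  let ?c = "\<lambda>p. FRR_cong X R M `` {p}"
  note c = rm_homD[OF class_hom]
  obtain p where p: "p \<in> carrier F" "a = ?c p"
    using assms by (auto simp: FRR_def FRR.quot_carrier)
  from p(1) have "(?c p, \<iota> (\<pi> (?c p))) \<in> sigma G"
  proof (induction rule: FR_induct)
    case (gen m)
    then show ?case using proj_iota[OF gen] iota_closed[OF gen] by (simp add: iota_def)
  next
    case one
    show ?case unfolding c(3) by (simp add: proj_simps iota_one)
  next
    case (mult p q)
    let ?a = "?c p" and ?b = "?c q"
    have ab: "?a \<in> carrier G" "?b \<in> carrier G" using mult c(1) by auto
    let ?m = "\<pi> ?a" and ?n = "\<pi> ?b"
    have mn: "?m \<in> carrier M" "?n \<in> carrier M" using ab proj_simps(1) by auto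
    let ?e = "rstar G (\<iota> ?m \<otimes>\<^bsub>G\<^esub> \<iota> ?n)"
    have "(?a \<otimes>\<^bsub>G\<^esub> ?b, \<iota> ?m \<otimes>\<^bsub>G\<^esub> \<iota> ?n) \<in> sigma G"
      using mult.IH sigma.cong unfolding congruence_def by blast
    then have 1: "(?a \<otimes>\<^bsub>G\<^esub> ?b, \<iota> (?m \<otimes>\<^bsub>M\<^esub> ?n) \<otimes>\<^bsub>G\<^esub> ?e) \<in> sigma G"
      using iota_mult[OF mn] by simp
    have "?e \<in> projections G" using mn by (intro projections_mem) simp
    then have "(?e, \<one>\<^bsub>G\<^esub>) \<in> sigma G" by (rule sigma_projections) (rule projections_mem)
    moreover have "(\<iota> (?m \<otimes>\<^bsub>M\<^esub> ?n), \<iota> (?m \<otimes>\<^bsub>M\<^esub> ?n)) \<in> sigma G" using mn by simp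
    ultimately have "(\<iota> (?m \<otimes>\<^bsub>M\<^esub> ?n) \<otimes>\<^bsub>G\<^esub> ?e, \<iota> (?m \<otimes>\<^bsub>M\<^esub> ?n) \<otimes>\<^bsub>G\<^esub> \<one>\<^bsub>G\<^esub>) \<in> sigma G"
      using sigma.cong unfolding congruence_def by blast
    then have "(\<iota> (?m \<otimes>\<^bsub>M\<^esub> ?n) \<otimes>\<^bsub>G\<^esub> ?e, \<iota> (?m \<otimes>\<^bsub>M\<^esub> ?n)) \<in> sigma G"
      using mn by simp
    with 1 have "(?a \<otimes>\<^bsub>G\<^esub> ?b, \<iota> (?m \<otimes>\<^bsub>M\<^esub> ?n)) \<in> sigma G"
      by (rule transD[OF sigma_trans])
    then show ?case using mult(1,2) ab by (simp only: c(2) proj_simps(2))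
  next
    case (star p)
    have a: "?c p \<in> carrier G" using star c(1) by auto
    show ?case unfolding c(4)[OF star(1)] proj_simps(4)[OF a] iota_one
      using a by (intro sigma_projections projections_mem)
  next
    case (plus p)
    have a: "?c p \<in> carrier G" using plus c(1) by auto
    show ?case unfolding c(5)[OF plus(1)] proj_simps(5)[OF a] iota_one
      using a by (intro sigma_projections projections_mem)
  qed
  then show ?thesis using p(2) by simp
qed

theorem kernel_proj: "sigma G = {(a, b). a \<in> carrier G \<and> b \<in> carrier G \<and> \<pi> a = \<pi> b}"
proof (intro subset_antisym subsetI)
  have "projections G \<times> projections G \<subseteq> {(a, b). a \<in> carrier G \<and> b \<in> carrier G \<and> \<pi> a = \<pi> b}"
    by (auto simp: projections_def proj_simps)
  then have "sigma G \<subseteq> {(a, b). a \<in> carrier G \<and> b \<in> carrier G \<and> \<pi> a = \<pi> b}"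
    unfolding sigma_def using G.congruence_kernel[OF proj_hom] by (intro cong_gen_least)
  then show "x \<in> {(a, b). a \<in> carrier G \<and> b \<in> carrier G \<and> \<pi> a = \<pi> b}" if "x \<in> sigma G" for x
    using that by blast
next
  fix x assume "x \<in> {(a, b). a \<in> carrier G \<and> b \<in> carrier G \<and> \<pi> a = \<pi> b}"
  then obtain a b where x: "x = (a, b)" "a \<in> carrier G" "b \<in> carrier G" "\<pi> a = \<pi> b" by auto
  then have "(a, \<iota> (\<pi> a)) \<in> sigma G" "(b, \<iota> (\<pi> a)) \<in> sigma G"
    using sigma_iota_proj[of a] sigma_iota_proj[of b] by simp_all
  then show "x \<in> sigma G" unfolding x(1) by (rule transD[OF sigma_trans _ symD[OF sigma_sym]])
qed

theorem proj_M_bar_class: "a \<in> carrier G \<Longrightarrow> proj_M_bar X R M (sigma_nat G a) = \<pi> a"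
proof -
  assume a: "a \<in> carrier G"
  then have "\<pi> ` sigma_nat G a = {\<pi> a}" by (auto simp: sigma_nat_def kernel_proj)
  then show ?thesis by (simp add: proj_M_bar_def)
qed

theorem proj_M_bar_iso: "proj_M_bar X R M \<in> iso (quot G (sigma G)) M"
proof -
  note cl = proj_M_bar_class[unfolded sigma_nat_def]
  have "bij_betw (proj_M_bar X R M) (carrier (quot G (sigma G))) (carrier M)"
    unfolding bij_betw_def
  proof
    show "inj_on (proj_M_bar X R M) (carrier (quot G (sigma G)))"
    proof (rule inj_onI)
      fix C D
      assume "C \<in> carrier (quot G (sigma G))" "D \<in> carrier (quot G (sigma G))"
        and eq: "proj_M_bar X R M C = proj_M_bar X R M D"
      then obtain a b where ab: "a \<in> carrier G" "b \<in> carrier G"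
          "C = sigma G `` {a}" "D = sigma G `` {b}"
        unfolding sigma.quot_carrier by blast
      with eq have "(a, b) \<in> sigma G" by (simp add: cl) (simp add: kernel_proj)
      then show "C = D" unfolding ab by (rule equiv_class_eq[OF sigma.eqv])
    qed
    have "m \<in> proj_M_bar X R M ` carrier (quot G (sigma G))" if "m \<in> carrier M" for m
      using cl[OF iota_closed[OF that]] proj_iota[OF that] iota_closed[OF that]
      by (metis sigma.quot_carrier image_eqI)
    then show "proj_M_bar X R M ` carrier (quot G (sigma G)) = carrier M"
      unfolding sigma.quot_carrier by (auto simp: cl proj_simps image_image)
  qed
  moreover have "proj_M_bar X R M \<in> hom (quot G (sigma G)) M"
    by (auto simp: hom_def sigma.quot_carrier cl proj_simps)
  ultimately show ?thesis by (simp add: iso_def)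
qed

end

end

theory Submission
  imports Defs
begin

text \<open>Every element \<open>a\<close> of \<open>FR\<^sub>R(M)\<close> satisfies \<open>a = a\<^sup>+ \<lfloor>p\<^sub>M(a)\<rfloor>\<close>: this holds for the generators and is
  inherited by products because \<open>\<lfloor>m\<rfloor>\<lfloor>n\<rfloor> \<le> \<lfloor>mn\<rfloor>\<close> and projections can be moved to the left of any
  element. Since the kernel of \<open>p\<^sub>M\<close> is \<open>\<sigma>\<close>, the element \<open>\<lfloor>m\<rfloor>\<close> is the maximum of its \<open>\<sigma>\<close>-class. For the
  universal property, \<open>\<tau>\<^sub>S\<close> is a premorphism, so it respects the defining relations of
  \<open>FR\<^sub>R(M)\<close> and extends to a morphism
  \<open>\<eta>\<close>; then \<open>p\<^sub>M\<close> and \<open>\<sigma>\<^sub>S\<^sup>\<natural> \<eta>\<close> are morphisms that agree on the generators.\<close>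

section \<open>Projections and the natural partial order\<close>

context restriction_semigroup
begin

text \<open>\<open>projections\<close> is defined through \<open>rstar\<close> alone; the axioms
  linking the two unary operations make \<open>rplus\<close> fix its elements as well.\<close>

lemma projectionsD:
  assumes "e \<in> projections S"
  shows "e \<in> carrier S" "rstar S e = e" "rplus S e = e" "e \<otimes> e = e"
proof -
  obtain x where x: "x \<in> carrier S" "e = rstar S x"
    using assms by (auto simp: projections_def)
  show e: "e \<in> carrier S" using x by (simp add: rstar_closed)
  show p: "rplus S e = e" using x by (simp add: rplus_rstar)
  show s: "rstar S e = e" using rstar_rplus[OF e] p by simp
  show "e \<otimes> e = e" using rstar_right[OF e] s by simp
qed

lemma rstar_projection: "x \<in> carrier S \<Longrightarrow> rstar S x \<in> projections S"
  by (simp add: projections_def)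

lemma rplus_projection: "x \<in> carrier S \<Longrightarrow> rplus S x \<in> projections S"
  using rstar_projection[OF rplus_closed] by (simp add: rstar_rplus)

lemma projections_mult:
  assumes "e \<in> projections S" "f \<in> projections S"
  shows "e \<otimes> f \<in> projections S"
proof -
  have "e \<otimes> f = rstar S (e \<otimes> f)"
    using rstar_mult[of e f] assms by (simp add: projectionsD)
  then show ?thesis
    using rstar_projection[of "e \<otimes> f"] assms by (simp add: projectionsD mult_closed)
qed

text \<open>From s = e t follows s^+ = e t^+, and t^+ t = t. Hence the projection witnessing s \<le>
  t can be taken to be s^+, which depends on s only.\<close>

lemma natural_le_rplus:
  assumes "natural_le S s t" "t \<in> carrier S"
  shows "s = rplus S s \<otimes> t"
proof -
  obtain e where e: "e \<in> projections S" "s = e \<otimes> t"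
    using assms(1) by (auto simp: natural_le_def)
  note pe = projectionsD[OF e(1)]
  have "rplus S s = e \<otimes> rplus S t"
    using rplus_mult[OF pe(1) assms(2)] pe(3) e(2) by simp
  then have "rplus S s \<otimes> t = e \<otimes> (rplus S t \<otimes> t)"
    using pe(1) assms(2) by (simp add: mult_assoc rplus_closed)
  then show ?thesis using e(2) assms(2) by (simp add: rplus_left)
qed

text \<open>The dual form: \<open>rstar_ample\<close> carries e across t to the right, where it
  becomes (e t)^* = s^*.\<close>

lemma natural_le_rstar:
  assumes "natural_le S s t" "t \<in> carrier S"
  shows "s = t \<otimes> rstar S s"
proof -
  obtain e where e: "e \<in> projections S" "s = e \<otimes> t"
    using assms(1) by (auto simp: natural_le_def)
  then show ?thesis
    using rstar_ample[of e t] assms(2) by (simp add: projectionsD)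
qed

text \<open>The order is defined by left multiples; \<open>rplus_ample\<close> turns the right
  multiple t e into (t e)^+ t.\<close>

lemma natural_le_mult_projection:
  assumes "t \<in> carrier S" "e \<in> projections S"
  shows "natural_le S (t \<otimes> e) t"
proof -
  note pe = projectionsD[OF assms(2)]
  have "t \<otimes> e = rplus S (t \<otimes> e) \<otimes> t"
    using rplus_ample[OF assms(1) pe(1)] pe(3) by simp
  then show ?thesis unfolding natural_le_def
    using rplus_projection[OF mult_closed[OF assms(1) pe(1)]] by blast
qed

lemma natural_le_refl: "s \<in> carrier S \<Longrightarrow> natural_le S s s"
  unfolding natural_le_def using rplus_left[of s] rplus_projection[of s] by metis

lemma natural_le_trans:
  assumes "natural_le S s t" "natural_le S t u" "u \<in> carrier S"
  shows "natural_le S s u"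
proof -
  obtain e f where e: "e \<in> projections S" "s = e \<otimes> t" and f: "f \<in> projections S" "t = f \<otimes> u"
    using assms(1,2) by (auto simp: natural_le_def)
  have "s = (e \<otimes> f) \<otimes> u"
    using e f assms(3) by (simp add: mult_assoc projectionsD)
  then show ?thesis unfolding natural_le_def using projections_mult[OF e(1) f(1)] by blast
qed

text \<open>In e s' f t' the inner f moves to the left of s' as (s' f)^+, so that both projections
  stand in front of s' t'.\<close>

lemma natural_le_mult:
  assumes "natural_le S s s'" "natural_le S t t'" "s' \<in> carrier S" "t' \<in> carrier S"
  shows "natural_le S (s \<otimes> t) (s' \<otimes> t')"
proof -
  obtain e f where e: "e \<in> projections S" "s = e \<otimes> s'" and f: "f \<in> projections S" "t = f \<otimes> t'"
    using assms(1,2) by (auto simp: natural_le_def)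
  let ?g = "rplus S (s' \<otimes> f)"
  note pe = projectionsD[OF e(1)] and pf = projectionsD[OF f(1)]
  have g: "?g \<in> projections S" using assms(3) pf(1) by (intro rplus_projection mult_closed)
  have "s \<otimes> t = e \<otimes> ((s' \<otimes> f) \<otimes> t')"
    using e f pe(1) pf(1) assms(3,4) by (simp add: mult_assoc mult_closed)
  also have "s' \<otimes> f = ?g \<otimes> s'"
    using rplus_ample[OF assms(3) pf(1)] pf(3) by simp
  also have "e \<otimes> ((?g \<otimes> s') \<otimes> t') = (e \<otimes> ?g) \<otimes> (s' \<otimes> t')"
    using pe(1) projectionsD(1)[OF g] assms(3,4) by (simp add: mult_assoc mult_closed)
  finally show ?thesis unfolding natural_le_def using projections_mult[OF e(1) g] by blast
qed

text \<open>With canonical witnesses s = s^+ t^+ s; the projections commute and s absorbs s^+, which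
  leaves t^+ s = t.\<close>

lemma natural_le_antisym:
  assumes "natural_le S s t" "natural_le S t s" "s \<in> carrier S" "t \<in> carrier S"
  shows "s = t"
proof -
  have s: "s = rplus S s \<otimes> t" and t: "t = rplus S t \<otimes> s"
    using assms by (blast intro: natural_le_rplus)+
  have "s = rplus S s \<otimes> (rplus S t \<otimes> s)" using s t by simp
  also have "\<dots> = (rplus S t \<otimes> rplus S s) \<otimes> s"
    using assms(3,4) by (simp add: mult_assoc[symmetric] rplus_closed rplus_comm)
  also have "\<dots> = rplus S t \<otimes> s"
    using assms(3,4) by (simp add: mult_assoc rplus_closed rplus_left)
  finally show ?thesis using t by simp
qed

text \<open>Antisymmetry makes maxima unique, so the definite description in \<open>tau\<close> is
  well defined as soon as some maximum is known.\<close>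

lemma tau_eqI:
  assumes "is_max S C m" "C \<subseteq> carrier S"
  shows "tau S C = m"
  unfolding tau_def
proof (rule the_equality)
  show "is_max S C m" by fact
  show "n = m" if "is_max S C n" for n
    using that assms by (blast intro: natural_le_antisym dest: is_max_def[THEN iffD1])
qed

end

section \<open>The identity element and the quotient by \<sigma>\<close>

context restriction_monoid
begin

lemma one_projection: "\<one> \<in> projections S"
proof -
  have "rstar S \<one> = \<one>" using rstar_right[of \<one>] by (simp add: rstar_closed)
  then show ?thesis using rstar_projection[of \<one>] by simp
qed

text \<open>If 1 = e u, then e = e (e u) = e u = 1 by idempotency, and so u = 1. This is what forces
  the maximum of the identity class to be 1.\<close>

lemma natural_le_one_imp:
  assumes "natural_le S \<one> u" "u \<in> carrier S"
  shows "u = \<one>"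
proof -
  obtain e where e: "e \<in> projections S" "\<one> = e \<otimes> u"
    using assms(1) by (auto simp: natural_le_def)
  note pe = projectionsD[OF e(1)]
  have "e = e \<otimes> (e \<otimes> u)" unfolding e(2)[symmetric] using pe(1) by simp
  also have "\<dots> = \<one>" using e(2) pe(1,4) assms(2) by (simp add: mult_assoc[symmetric])
  finally show ?thesis using e(2) l_one[OF assms(2)] by metis
qed

lemma sigma_rm_congruence: "rm_congruence S (sigma S)"
proof -
  interpret rm_algebra S by (rule is_rm_algebra)
  show "rm_congruence S (sigma S)"
    by unfold_locales (auto simp: sigma_def projectionsD intro!: congruence_gen)
qed

lemma sigma_one:
  assumes "e \<in> projections S"
  shows "sigma S `` {e} = \<one>\<^bsub>quot S (sigma S)\<^esub>"
proof -
  interpret sigma: rm_congruence S "sigma S" by (rule sigma_rm_congruence)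
  have "(e, \<one>) \<in> sigma S"
    using assms one_projection cong_gen_incl[of "projections S \<times> projections S" S]
    by (auto simp: sigma_def)
  then show ?thesis using equiv_class_eq[OF sigma.eqv] by simp
qed

text \<open>\<open>iso\<close> and \<open>hom\<close> do not mention the identity; it is preserved because \<open>\<theta>\<close> is surjective.\<close>

lemma iso_sigma_rm_hom:
  assumes "monoid M" "\<theta> \<in> iso M (quot S (sigma S))"
  shows "\<theta> \<in> rm_hom (reduced M) (quot S (sigma S))"
proof -
  let ?Q = "quot S (sigma S)"
  interpret M: monoid M by fact
  interpret sigma: rm_congruence S "sigma S" by (rule sigma_rm_congruence)
  interpret Q: restriction_monoid ?Q
    by (intro restriction_monoid_quot restriction_monoid_axioms sigma.cong)
  have hom: "\<theta> \<in> hom M ?Q" and surj: "\<theta> ` carrier M = carrier ?Q"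
    using assms(2) by (auto simp: iso_def bij_betw_def)
  obtain u where u: "u \<in> carrier M" "\<theta> u = \<one>\<^bsub>?Q\<^esub>"
    using surj Q.one_closed by (metis imageE)
  have "\<theta> \<one>\<^bsub>M\<^esub> = \<theta> \<one>\<^bsub>M\<^esub> \<otimes>\<^bsub>?Q\<^esub> \<theta> u"
    using hom u(2) Q.r_one[of "\<theta> \<one>\<^bsub>M\<^esub>"] by (simp add: hom_def Pi_iff)
  also have "\<dots> = \<one>\<^bsub>?Q\<^esub>" using hom_mult[OF hom M.one_closed u(1)] u by simp
  finally have one: "\<theta> \<one>\<^bsub>M\<^esub> = \<one>\<^bsub>?Q\<^esub>" .
  \<comment> \<open>Every projection is \<sigma>-related to 1, so the quotient is reduced and
    \<theta> respects both unary operations.\<close>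
  have "rstar ?Q C = \<one>\<^bsub>?Q\<^esub> \<and> rplus ?Q C = \<one>\<^bsub>?Q\<^esub>" if C: "C \<in> carrier ?Q" for C
  proof -
    obtain a where a: "a \<in> carrier S" "C = sigma S `` {a}"
      using C unfolding sigma.quot_carrier by blast
    show ?thesis unfolding a(2) sigma.quot_star[OF a(1)] sigma.quot_plus[OF a(1)]
      using a(1) by (intro conjI sigma_one rstar_projection rplus_projection)
  qed
  with hom one show ?thesis
    by (auto simp: rm_hom_def mon_hom_def hom_def reduced_def)
qed

end

section \<open>Values of identities and the universal property of \<open>FRR\<close>\<close>

text \<open>As functions of p both sides are morphisms on the free restriction monoid with the same
  values on generators. Thus a morphism transports values of identities.\<close>

lemma identity_value_hom:
  assumes "restriction_monoid S" "h \<in> rm_hom S T" "monoid M" "\<gamma> \<in> carrier M \<rightarrow> carrier S"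
    and \<delta>: "\<And>m. m \<in> carrier M \<Longrightarrow> h (\<gamma> m) = \<delta> m"
    and f: "f \<in> X \<rightarrow> carrier M" and p: "p \<in> carrier (FR (lists X))"
  shows "identity_value X M T \<delta> f p = h (identity_value X M S \<gamma> f p)"
proof -
  have w: "word_ext M f u \<in> carrier M" if "u \<in> lists X" for u
    using word_ext_closed[OF assms(3) f that] .
  have g: "\<gamma> (word_ext M f u) \<in> carrier S" if "u \<in> lists X" for u
    using assms(4) w[OF that] by blast
  have v: "identity_value X M S \<gamma> f \<in> rm_hom (FR (lists X)) S"
    unfolding identity_value_def by (rule free_ext_hom(1)[OF assms(1) g])
  have "h (identity_value X M S \<gamma> f (fgen (lists X) u)) = \<delta> (word_ext M f u)"
    if "u \<in> lists X" for u
  proof -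
    have "identity_value X M S \<gamma> f (fgen (lists X) u) = \<gamma> (word_ext M f u)"
      unfolding identity_value_def by (rule free_ext_hom(2)[OF assms(1) g that])
    then show ?thesis using \<delta>[OF w[OF that]] by simp
  qed
  from free_ext_eqI[OF rm_hom_comp[OF v assms(2)] this p] show ?thesis
    by (simp add: identity_value_def)
qed

context admissible_presentation
begin

text \<open>The extension \<open>h\<close> of \<phi> to the free restriction monoid \<open>F\<close>
  identifies the two sides of each defining relation, and therefore factors through the quotient
  \<open>G\<close>.\<close>

theorem FRR_universal:
  assumes S: "restriction_monoid S" and closed: "\<phi> \<in> carrier M \<rightarrow> carrier S"
    and one: "\<phi> \<one>\<^bsub>M\<^esub> = \<one>\<^bsub>S\<^esub>"
    and premorphism: "\<And>m n. \<lbrakk>m \<in> carrier M; n \<in> carrier M\<rbrakk>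
      \<Longrightarrow> natural_le S (\<phi> m \<otimes>\<^bsub>S\<^esub> \<phi> n) (\<phi> (m \<otimes>\<^bsub>M\<^esub> n))"
    and sat: "\<forall>e\<in>R. satisfies X M S \<phi> e"
  shows "\<exists>\<eta>\<in>rm_hom G S. \<forall>m\<in>carrier M. \<eta> (\<iota> m) = \<phi> m"
proof -
  interpret S: restriction_monoid S by fact
  let ?g = "fgen (carrier M)"
  have \<phi>c: "\<phi> m \<in> carrier S" if "m \<in> carrier M" for m using closed that by blast
  have "\<exists>h\<in>rm_hom F S. \<forall>m\<in>carrier M. h (?g m) = \<phi> m"
    by (rule free_ext_exists[OF S \<phi>c])
  then obtain h where h: "h \<in> rm_hom F S" and hg: "\<forall>m\<in>carrier M. h (?g m) = \<phi> m"
    by (rule bexE)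
  note hg = hg[rule_format]
  \<comment> \<open>The premorphism inequality in right-handed form is exactly the image under
    \<open>h\<close> of the product relation.\<close>
  have mult: "\<phi> m \<otimes>\<^bsub>S\<^esub> \<phi> n = \<phi> (m \<otimes>\<^bsub>M\<^esub> n) \<otimes>\<^bsub>S\<^esub> rstar S (\<phi> m \<otimes>\<^bsub>S\<^esub> \<phi> n)"
    if "m \<in> carrier M" "n \<in> carrier M" for m n
    using S.natural_le_rstar[OF premorphism[OF that]] that \<phi>c by simp
  have F: "restriction_monoid F" by (rule FR_restriction_monoid)
  have gc: "?g \<in> carrier M \<rightarrow> carrier F" by (auto simp: fgen_closed)
  have rel: "h (identity_value X M F ?g f p) = h (identity_value X M F ?g f q)"
    if "(p, q) \<in> R" "f \<in> X \<rightarrow> carrier M" for p q f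
  proof -
    have pq: "p \<in> carrier (FR (lists X))" "q \<in> carrier (FR (lists X))"
      using R that(1) by (auto simp: identities_def)
    have "identity_value X M S \<phi> f p = identity_value X M S \<phi> f q"
      using sat that by (force simp: satisfies_def)
    then show ?thesis
      using identity_value_hom[OF F h M.monoid_axioms gc hg that(2)] pq by simp
  qed
  have "h a = h b" if "(a, b) \<in> FRR_rels X R M" for a b
    using that unfolding FRR_rels_def Let_def
  proof (elim UnE CollectE exE conjE)
    assume "(a, b) \<in> {(?g \<one>\<^bsub>M\<^esub>, \<one>\<^bsub>F\<^esub>)}"
    then show ?thesis by (simp add: hg one rm_homD[OF h])
  next
    fix m n assume "m \<in> carrier M" "n \<in> carrier M"
      "(a, b) = (?g m \<otimes>\<^bsub>F\<^esub> ?g n, ?g (m \<otimes>\<^bsub>M\<^esub> n) \<otimes>\<^bsub>F\<^esub> rstar F (?g m \<otimes>\<^bsub>F\<^esub> ?g n))"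
    then show ?thesis using mult[of m n]
      by (simp add: rm_homD[OF h] hg fgen_closed FR.rstar_closed FR.mult_closed)
  next
    fix p q f assume "(p, q) \<in> R" "f \<in> X \<rightarrow> carrier M"
      "(a, b) = (identity_value X M F ?g f p, identity_value X M F ?g f q)"
    then show ?thesis using rel[of p q f] by simp
  qed
  then have "FRR_rels X R M \<subseteq> {(a, b). a \<in> carrier F \<and> b \<in> carrier F \<and> h a = h b}"
    using rels_carrier by blast
  \<comment> \<open>The kernel of \<open>h\<close> is a congruence, so containing the relations it
    contains the congruence they generate.\<close>
  then have "FRR_cong X R M \<subseteq> {(a, b). a \<in> carrier F \<and> b \<in> carrier F \<and> h a = h b}"
    unfolding FRR_cong_def using FRR.congruence_kernel[OF h] by (intro cong_gen_least)
  then have "h a = h b" if "(a, b) \<in> FRR_cong X R M" for a b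
    using that by blast
  from FRR.quot_lift[OF h this] obtain k
    where k: "k \<in> rm_hom G S" "\<forall>a\<in>carrier F. k (FRR_cong X R M `` {a}) = h a"
    unfolding FRR_def by (rule bexE)
  note k = k(1) k(2)[rule_format]
  have "k (\<iota> m) = \<phi> m" if "m \<in> carrier M" for m
    unfolding iota_def using k(2)[OF fgen_closed[OF that]] hg[OF that] by simp
  with k(1) show ?thesis by blast
qed

section \<open>Maxima of the \<sigma>-classes of \<open>FRR\<close>, and properness\<close>

lemma natural_le_iota_proj:
  assumes "a \<in> carrier G"
  shows "natural_le G a (\<iota> (\<pi> a))"
proof -
  let ?c = "\<lambda>p. FRR_cong X R M `` {p}"
  note c = rm_homD[OF class_hom]
  \<comment> \<open>This settles the \<open>star\<close> and \<open>plus\<close> cases: there \<pi>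
    takes the value 1, and \<open>\<iota>\<close> sends 1 to the identity of
    \<open>G\<close>.\<close>
  have le_one: "natural_le G e \<one>\<^bsub>G\<^esub>" if "e \<in> projections G" for e
    using G.natural_le_mult_projection[OF G.one_closed that] G.projectionsD(1)[OF that] by simp
  obtain p where p: "p \<in> carrier F" "a = ?c p"
    using assms by (auto simp: FRR_def FRR.quot_carrier)
  from p(1) have "natural_le G (?c p) (\<iota> (\<pi> (?c p)))"
  proof (induction rule: FR_induct)
    case (gen m)
    then show ?case
      using proj_iota[OF gen] G.natural_le_refl[OF iota_closed[OF gen]] by (simp add: iota_def)
  next
    case one
    show ?case unfolding c(3) by (simp add: proj_simps iota_one G.natural_le_refl)
  next
    case (mult p q)
    let ?m = "\<pi> (?c p)" and ?n = "\<pi> (?c q)"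
    have ab: "?c p \<in> carrier G" "?c q \<in> carrier G" using mult c(1) by auto
    then have mn: "?m \<in> carrier M" "?n \<in> carrier M" using proj_simps(1) by auto
    have "natural_le G (?c p \<otimes>\<^bsub>G\<^esub> ?c q) (\<iota> ?m \<otimes>\<^bsub>G\<^esub> \<iota> ?n)"
      using mult.IH mn by (intro G.natural_le_mult iota_closed)
    \<comment> \<open>The defining relation exhibits the product as a right multiple of the larger
      element by a projection.\<close>
    moreover have "natural_le G (\<iota> ?m \<otimes>\<^bsub>G\<^esub> \<iota> ?n) (\<iota> (?m \<otimes>\<^bsub>M\<^esub> ?n))"
      by (subst iota_mult[OF mn], intro G.natural_le_mult_projection G.rstar_projection)
        (simp_all add: mn)
    ultimately have "natural_le G (?c p \<otimes>\<^bsub>G\<^esub> ?c q) (\<iota> (?m \<otimes>\<^bsub>M\<^esub> ?n))"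
      by (rule G.natural_le_trans) (intro iota_closed M.m_closed mn)
    then show ?case using mult(1,2) ab by (simp only: c(2) proj_simps(2))
  next
    case (star p)
    then have "?c p \<in> carrier G" using c(1) by auto
    then show ?case unfolding c(4)[OF star(1)]
      by (simp add: proj_simps iota_one le_one G.rstar_projection)
  next
    case (plus p)
    then have "?c p \<in> carrier G" using c(1) by auto
    then show ?case unfolding c(5)[OF plus(1)]
      by (simp add: proj_simps iota_one le_one G.rplus_projection)
  qed
  then show ?thesis using p(2) by simp
qed

text \<open>By \<open>kernel_proj\<close> all elements of the class share one image under \<pi>, so
  their individual upper bounds coincide.\<close>

lemma is_max_iota:
  assumes "a \<in> carrier G"
  shows "is_max G (sigma G `` {a}) (\<iota> (\<pi> a))"
  unfolding is_max_def
proof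
  show "\<iota> (\<pi> a) \<in> sigma G `` {a}" using sigma_iota_proj[OF assms] by simp
  show "\<forall>s\<in>sigma G `` {a}. natural_le G s (\<iota> (\<pi> a))"
    using natural_le_iota_proj by (auto simp: kernel_proj)
qed

theorem FRR_F_restriction: "F_restriction G"
  unfolding F_restriction_def
  using G.restriction_semigroup_axioms is_max_iota by (auto elim!: quotientE)

text \<open>\<open>proj_M_bar\<close> is the identification of the quotient by \<sigma> with M;
  under it the claim reads \<tau> = \<iota>.\<close>

theorem tau_FRR:
  assumes "C \<in> carrier (quot G (sigma G))"
  shows "tau G C = \<iota> (proj_M_bar X R M C)"
proof -
  obtain a where a: "a \<in> carrier G" "C = sigma G `` {a}"
    using assms by (auto simp: sigma.quot_carrier)
  have "tau G C = \<iota> (\<pi> a)"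
    unfolding a(2) using is_max_iota[OF a(1)] sigma.in_carrier by (intro G.tau_eqI) auto
  then show ?thesis using proj_M_bar_class[OF a(1)] a(2) by (simp add: sigma_nat_def)
qed

text \<open>Two \<sigma>-related elements lie below the same maximum, and an element below it is
  recovered from that maximum by either \<open>rstar\<close> or \<open>rplus\<close>.\<close>

theorem FRR_proper: "proper G"
  unfolding proper_def
proof (intro conjI ballI impI G.restriction_semigroup_axioms; elim conjE)
  fix s t assume st: "s \<in> carrier G" "t \<in> carrier G" "(s, t) \<in> sigma G"
  then have eq: "\<pi> s = \<pi> t" by (simp add: kernel_proj)
  have le: "natural_le G s (\<iota> (\<pi> s))" "natural_le G t (\<iota> (\<pi> s))" "\<iota> (\<pi> s) \<in> carrier G"
    using natural_le_iota_proj[OF st(1)] natural_le_iota_proj[OF st(2)] eq proj_simps(1)[OF st(1)] by simp_all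
  show "s = t" if "rstar G s = rstar G t"
    using G.natural_le_rstar[OF le(1,3)] G.natural_le_rstar[OF le(2,3)] that by simp
  show "s = t" if "rplus G s = rplus G t"
    using G.natural_le_rplus[OF le(1,3)] G.natural_le_rplus[OF le(2,3)] that by simp
qed

section \<open>The morphism onto the maxima of an F-restriction monoid\<close>

theorem F_restriction_universal:
  assumes S: "restriction_monoid S" "F_restriction S" and \<theta>: "\<theta> \<in> iso M (quot S (sigma S))"
    and sat: "\<forall>e\<in>R. satisfies X M S (\<lambda>m. tau S (\<theta> m)) e"
  shows "\<exists>\<eta>\<in>rm_hom G S. (\<forall>m\<in>carrier M. \<eta> (\<iota> m) = tau S (\<theta> m))
    \<and> (\<forall>a\<in>carrier G. \<theta> (\<pi> a) = sigma_nat S (\<eta> a))"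
proof -
  interpret S: restriction_monoid S by fact
  interpret sigma_S: rm_congruence S "sigma S" by (rule S.sigma_rm_congruence)
  let ?Q = "quot S (sigma S)"
  define \<phi> where "\<phi> m = tau S (\<theta> m)" for m
  have hom: "\<theta> \<in> rm_hom (reduced M) ?Q" by (rule S.iso_sigma_rm_hom[OF M.monoid_axioms \<theta>])
  note \<theta>D = rm_homD[OF hom, unfolded reduced_def, simplified]
  have max: "is_max S (\<theta> m) (\<phi> m)" and sub: "\<theta> m \<subseteq> carrier S" if "m \<in> carrier M" for m
  proof -
    have m: "\<theta> m \<in> carrier S // sigma S" using \<theta>D(1)[OF that] by (simp add: quot_def)
    then show sub: "\<theta> m \<subseteq> carrier S" using sigma_S.in_carrier by (auto elim!: quotientE)
    obtain t where "is_max S (\<theta> m) t" using S(2) m by (auto simp: F_restriction_def)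
    then show "is_max S (\<theta> m) (\<phi> m)" unfolding \<phi>_def using S.tau_eqI[OF _ sub] by metis
  qed
  have mem: "\<phi> m \<in> \<theta> m" and le: "s \<in> \<theta> m \<Longrightarrow> natural_le S s (\<phi> m)" and closed: "\<phi> m \<in> carrier S"
    if "m \<in> carrier M" for m s
    using max[OF that] sub[OF that] by (auto simp: is_max_def)
  \<comment> \<open>The maximum of a class represents that class: \<tau> is a section of the
    quotient map.\<close>
  have cls: "sigma S `` {\<phi> m} = \<theta> m" if "m \<in> carrier M" for m
  proof -
    have "\<theta> m \<in> carrier S // sigma S" using \<theta>D(1)[OF that] by (simp add: quot_def)
    then obtain s where s: "\<theta> m = sigma S `` {s}" by (auto elim!: quotientE)
    then have "(s, \<phi> m) \<in> sigma S" using mem[OF that] by simp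
    then show ?thesis using equiv_class_eq[OF sigma_S.eqv] s by metis
  qed
  have "\<exists>\<eta>\<in>rm_hom G S. \<forall>m\<in>carrier M. \<eta> (\<iota> m) = \<phi> m"
  proof (rule FRR_universal[OF S(1)])
    show "\<phi> \<in> carrier M \<rightarrow> carrier S" using closed by blast
    \<comment> \<open>Since 1 lies in the identity class, it is below the maximum of that class,
      which must then be 1.\<close>
    have "\<one>\<^bsub>S\<^esub> \<in> \<theta> \<one>\<^bsub>M\<^esub>" using \<theta>D(3) by simp
    then show "\<phi> \<one>\<^bsub>M\<^esub> = \<one>\<^bsub>S\<^esub>" using S.natural_le_one_imp le closed by simp
    show "natural_le S (\<phi> m \<otimes>\<^bsub>S\<^esub> \<phi> n) (\<phi> (m \<otimes>\<^bsub>M\<^esub> n))"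
      if mn: "m \<in> carrier M" "n \<in> carrier M" for m n
    proof (rule le)
      \<comment> \<open>\<theta> is multiplicative, so the product of the two maxima lies in the
        class of the product and hence below its maximum.\<close>
      have "\<theta> (m \<otimes>\<^bsub>M\<^esub> n) = sigma S `` {\<phi> m \<otimes>\<^bsub>S\<^esub> \<phi> n}"
        using \<theta>D(2)[OF mn] cls[OF mn(1)] cls[OF mn(2)] closed[OF mn(1)] closed[OF mn(2)]
        by (metis sigma_S.quot_mult)
      then show "\<phi> m \<otimes>\<^bsub>S\<^esub> \<phi> n \<in> \<theta> (m \<otimes>\<^bsub>M\<^esub> n)"
        using closed mn by simp
    qed (use mn in simp)
    show "\<forall>e\<in>R. satisfies X M S \<phi> e" using sat by (simp add: \<phi>_def[abs_def])
  qed
  then obtain \<eta> where \<eta>: "\<eta> \<in> rm_hom G S" "\<And>m. m \<in> carrier M \<Longrightarrow> \<eta> (\<iota> m) = \<phi> m" by blast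
  \<comment> \<open>Both sides are morphisms from \<open>G\<close> to the quotient of S, and on the
    generator \<open>\<iota> m\<close> both give the class \<open>\<theta> m\<close> by
    \<open>cls\<close>.\<close>
  have "\<theta> (\<pi> a) = sigma_nat S (\<eta> a)" if "a \<in> carrier G" for a
    unfolding sigma_nat_def
    by (rule FRR_hom_unique[OF rm_hom_comp[OF proj_hom hom] rm_hom_comp[OF \<eta>(1) sigma_S.class_hom] _ that])
      (simp add: proj_iota \<eta>(2) cls)
  then show ?thesis using \<eta> unfolding \<phi>_def by blast
qed

end

theorem proposition5p4:
  fixes M :: "'m monoid" and X :: "'x set" and R :: "'x ident set"
  assumes "monoid M"
    and "R \<subseteq> identities X"
    and "\<forall>e\<in>R. admissible X e"
  shows
    "(F_restriction (FRR X R M)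
      \<and> (\<forall>C\<in>carrier (quot (FRR X R M) (sigma (FRR X R M))).
           tau (FRR X R M) C = iota X R M (proj_M_bar X R M C))
      \<and> proper (FRR X R M))
    \<and> (\<forall>(S :: 's rmonoid) \<theta>.
         restriction_monoid S \<and> F_restriction S
         \<and> \<theta> \<in> iso M (quot S (sigma S))
         \<and> (\<forall>e\<in>R. satisfies X M S (\<lambda>m. tau S (\<theta> m)) e)
         \<longrightarrow> (\<exists>\<eta>\<in>rm_hom (FRR X R M) S.
                (\<forall>m\<in>carrier M. \<eta> (iota X R M m) = tau S (\<theta> m))
                \<and> (\<forall>a\<in>carrier (FRR X R M). \<theta> (proj_M X R M a) = sigma_nat S (\<eta> a))))"
proof -
  interpret admissible_presentation M X R
    using assms by (intro admissible_presentation.intro admissible_presentation_axioms.intro)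
  show ?thesis
    by (intro conjI ballI allI impI FRR_F_restriction tau_FRR FRR_proper, assumption)
      (elim conjE, rule F_restriction_universal)
qed

end
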